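(* Let $S$ be an inverse semigroup and let $\rho$ be a normal congruence on $E(S)$. Then $G_u(S/\nu_{\rho,\min})$ is isomorphic (as an étale topological groupoid) to $G_u(S)_{F_\rho}$.
   Context: An inverse semigroup is a semigroup $S$ in which every $s$ has a unique $s^*$ with $s=ss^*s$, $s^*=s^*ss^*$. $E(S)$ is the (commutative) semigroup of idempotents. A congruence on a semigroup is an equivalence relation compatible with left and right multiplication. A congruence $\rho$ on $E(S)$ is normal if $(e,f)\in\rho$ implies $(ses^*,sfs^* )\in\rho$ for all $s\in S$. For such $\rho$, $\nu_{\rho,\min}$ is the congruence on $S$ given by: $(s,t)\in\nu_{\rho,\min}$ iff $(s^*s,t^*t)\in\rho$ and $se=te$ for some $e\in E(S)$ with $(e,s^*s)\in\rho$. It is the minimum congruence on $S$ whose restriction to $E(S)$ is $\rho$. For a commutative semigroup $E$ of idempotents, $\widehat{E}$ is the set of nonzero semigroup homomorphisms $E\to\{0,1\}$ with the topology of pointwise convergence. For $e\in E(S)$ let $D_e=\{\xi\in\widehat{E(S)}:\xi(e)=1\}$; for $s\in S$ and $\xi\in D_{s^*s}$ let $\beta_s(\xi)\in D_{ss^*}$ be $\beta_s(\xi)(e)=\xi(s^*es)$. Universal groupoid $G_u(S)$: the set of classes $[s,\xi]$ of pairs $(s,\xi)\in S\times\widehat{E(S)}$ with $\xi(s^*s)=1$, where $(s,\xi)\sim(t,\eta)$ iff $\xi=\eta$ and there is $e\in E(S)$ with $\xi(e)=1$ and $se=te$. The unit space is $\widehat{E(S)}$ (via $\xi\mapsto[e,\xi]$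 for any $e$ with $\xi(e)=1$), $d([s,\xi])=\xi$, $r([s,\xi])=\beta_s(\xi)$, $[s,\beta_t(\xi)][t,\xi]=[st,\xi]$, $[s,\xi]^{-1}=[s^*,\beta_s(\xi)]$. The sets $\{[s,\xi]:\xi\in U\}$, with $s\in S$ and $U\subset D_{s^*s}$ open, form a basis of the topology; $G_u(S)$ is an étale groupoid. With $q\colon E(S)\to E(S)/\rho$ the quotient map, $F_\rho=\{\eta\circ q:\eta\in\widehat{E(S)/\rho}\}$, a closed invariant subset of $\widehat{E(S)}=G_u(S)^{(0)}$ (invariant: $d(\alpha)\in F_\rho\Rightarrow r(\alpha)\in F_\rho$). $G_u(S)_{F_\rho}=d^{-1}(F_\rho)$ with the relative topology. *)

theory Defs
  imports "HOL-Analysis.Analysis"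
begin

section \<open>Inverse semigroups and their congruences\<close>

text \<open>Semigroups are records with an explicit carrier, because the statement also needs the
  semigroup of idempotents and quotient semigroups.\<close>

record 'a sgrp =
  carrier :: "'a set"
  mult :: "'a \<Rightarrow> 'a \<Rightarrow> 'a" (infixl "\<otimes>\<index>" 70)

locale inverse_semigroup =
  fixes S :: "'a sgrp" (structure)
  assumes closed: "\<lbrakk>s \<in> carrier S; t \<in> carrier S\<rbrakk> \<Longrightarrow> s \<otimes> t \<in> carrier S"
    and assoc: "\<lbrakk>s \<in> carrier S; t \<in> carrier S; u \<in> carrier S\<rbrakk> \<Longrightarrow> (s \<otimes> t) \<otimes> u = s \<otimes> (t \<otimes> u)"
    and ex1_star: "s \<in> carrier S \<Longrightarrow>
      \<exists>!t. t \<in> carrier S \<and> s = s \<otimes> t \<otimes> s \<and> t = t \<otimes> s \<otimes> t"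

definition star :: "'a sgrp \<Rightarrow> 'a \<Rightarrow> 'a" where
  "star S s = (THE t. t \<in> carrier S \<and> s = s \<otimes>\<^bsub>S\<^esub> t \<otimes>\<^bsub>S\<^esub> s \<and> t = t \<otimes>\<^bsub>S\<^esub> s \<otimes>\<^bsub>S\<^esub> t)"

definition idem :: "'a sgrp \<Rightarrow> 'a sgrp" where
  "idem S = \<lparr>carrier = {e \<in> carrier S. e \<otimes>\<^bsub>S\<^esub> e = e}, mult = mult S\<rparr>"

definition sgrp_congruence :: "'a sgrp \<Rightarrow> ('a \<times> 'a) set \<Rightarrow> bool" where
  "sgrp_congruence S \<rho> \<longleftrightarrow> equiv (carrier S) \<rho> \<and>
     (\<forall>(s, t) \<in> \<rho>. \<forall>u \<in> carrier S.
        (u \<otimes>\<^bsub>S\<^esub> s, u \<otimes>\<^bsub>S\<^esub> t) \<in> \<rho> \<and> (s \<otimes>\<^bsub>S\<^esub> u, t \<otimes>\<^bsub>S\<^esub> u) \<in> \<rho>)"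

definition normal_congruence :: "'a sgrp \<Rightarrow> ('a \<times> 'a) set \<Rightarrow> bool" where
  "normal_congruence S \<rho> \<longleftrightarrow> sgrp_congruence (idem S) \<rho> \<and>
     (\<forall>(e, f) \<in> \<rho>. \<forall>s \<in> carrier S.
        (s \<otimes>\<^bsub>S\<^esub> e \<otimes>\<^bsub>S\<^esub> star S s, s \<otimes>\<^bsub>S\<^esub> f \<otimes>\<^bsub>S\<^esub> star S s) \<in> \<rho>)"

definition nu_min :: "'a sgrp \<Rightarrow> ('a \<times> 'a) set \<Rightarrow> ('a \<times> 'a) set" where
  "nu_min S \<rho> = {(s, t). s \<in> carrier S \<and> t \<in> carrier S \<and>
     (star S s \<otimes>\<^bsub>S\<^esub> s, star S t \<otimes>\<^bsub>S\<^esub> t) \<in> \<rho> \<and>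
     (\<exists>e \<in> carrier (idem S). (e, star S s \<otimes>\<^bsub>S\<^esub> s) \<in> \<rho> \<and> s \<otimes>\<^bsub>S\<^esub> e = t \<otimes>\<^bsub>S\<^esub> e)}"

text \<open>For a congruence, all terms of the union below are the same class.\<close>

definition quot_sgrp :: "'a sgrp \<Rightarrow> ('a \<times> 'a) set \<Rightarrow> 'a set sgrp" where
  "quot_sgrp S \<rho> = \<lparr>carrier = carrier S // \<rho>,
     mult = (\<lambda>A B. \<Union>s\<in>A. \<Union>t\<in>B. \<rho> `` {s \<otimes>\<^bsub>S\<^esub> t})\<rparr>"


section \<open>The character space\<close>

text \<open>Functions on the carrier are extensional (equal to \<^term>\<open>undefined\<close> outside it), so that
  pointwise convergence is the product topology of discrete two-point spaces.\<close>

definition characters :: "'a sgrp \<Rightarrow> ('a \<Rightarrow> nat) set" where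
  "characters E = {\<xi> \<in> carrier E \<rightarrow>\<^sub>E {0, 1}.
     (\<forall>e \<in> carrier E. \<forall>f \<in> carrier E. \<xi> (e \<otimes>\<^bsub>E\<^esub> f) = \<xi> e * \<xi> f) \<and>
     (\<exists>e \<in> carrier E. \<xi> e \<noteq> 0)}"

definition character_space :: "'a sgrp \<Rightarrow> ('a \<Rightarrow> nat) topology" where
  "character_space E =
     subtopology (product_topology (\<lambda>_. discrete_topology {0, 1}) (carrier E)) (characters E)"

definition D_set :: "'a sgrp \<Rightarrow> 'a \<Rightarrow> ('a \<Rightarrow> nat) set" where
  "D_set S e = {\<xi> \<in> characters (idem S). \<xi> e = 1}"

definition beta :: "'a sgrp \<Rightarrow> 'a \<Rightarrow> ('a \<Rightarrow> nat) \<Rightarrow> ('a \<Rightarrow> nat)" where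
  "beta S s \<xi> = (\<lambda>e \<in> carrier (idem S). \<xi> (star S s \<otimes>\<^bsub>S\<^esub> e \<otimes>\<^bsub>S\<^esub> s))"

definition F_set :: "'a sgrp \<Rightarrow> ('a \<times> 'a) set \<Rightarrow> ('a \<Rightarrow> nat) set" where
  "F_set S \<rho> = (\<lambda>\<eta>. \<lambda>e \<in> carrier (idem S). \<eta> (\<rho> `` {e})) ` characters (quot_sgrp (idem S) \<rho>)"


section \<open>Topological groupoids\<close>

text \<open>The arrows are the points of the topology, and units are arrows: \<open>gdom\<close> and \<open>grng\<close> take
  values in the unit space. The composite of \<open>a\<close> and \<open>b\<close> is meaningful if
  \<open>gdom a = grng b\<close>.\<close>

record 'g tgroupoid =
  arr_top :: "'g topology"
  gdom :: "'g \<Rightarrow> 'g"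
  grng :: "'g \<Rightarrow> 'g"
  gcomp :: "'g \<Rightarrow> 'g \<Rightarrow> 'g"
  ginv :: "'g \<Rightarrow> 'g"

abbreviation arrows :: "'g tgroupoid \<Rightarrow> 'g set" where
  "arrows G \<equiv> topspace (arr_top G)"

text \<open>Being an etale groupoid is a property of the underlying topological groupoid, so
  isomorphisms of etale groupoids are the isomorphisms of topological groupoids.\<close>

definition tgroupoid_iso :: "'g tgroupoid \<Rightarrow> 'h tgroupoid \<Rightarrow> ('g \<Rightarrow> 'h) \<Rightarrow> bool" where
  "tgroupoid_iso G H \<phi> \<longleftrightarrow>
     homeomorphic_map (arr_top G) (arr_top H) \<phi> \<and>
     (\<forall>a \<in> arrows G. \<phi> (gdom G a) = gdom H (\<phi> a) \<and> \<phi> (grng G a) = grng H (\<phi> a) \<and>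
        \<phi> (ginv G a) = ginv H (\<phi> a)) \<and>
     (\<forall>a \<in> arrows G. \<forall>b \<in> arrows G. gdom G a = grng G b \<longrightarrow>
        \<phi> (gcomp G a b) = gcomp H (\<phi> a) (\<phi> b))"

definition isomorphic_tgroupoids :: "'g tgroupoid \<Rightarrow> 'h tgroupoid \<Rightarrow> bool" where
  "isomorphic_tgroupoids G H \<longleftrightarrow> (\<exists>\<phi>. tgroupoid_iso G H \<phi>)"

text \<open>The reduction to an invariant set \<open>F\<close> of units.\<close>

definition reduction :: "'g tgroupoid \<Rightarrow> 'g set \<Rightarrow> 'g tgroupoid" where
  "reduction G F = G\<lparr>arr_top := subtopology (arr_top G) {a \<in> arrows G. gdom G a \<in> F}\<rparr>"


section \<open>The universal groupoid\<close>

definition germ_pairs :: "'a sgrp \<Rightarrow> ('a \<times> ('a \<Rightarrow> nat)) set" where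
  "germ_pairs S = {(s, \<xi>). s \<in> carrier S \<and> \<xi> \<in> D_set S (star S s \<otimes>\<^bsub>S\<^esub> s)}"

definition germ_rel :: "'a sgrp \<Rightarrow> (('a \<times> ('a \<Rightarrow> nat)) \<times> ('a \<times> ('a \<Rightarrow> nat))) set" where
  "germ_rel S = {((s, \<xi>), (t, \<eta>)). (s, \<xi>) \<in> germ_pairs S \<and> (t, \<eta>) \<in> germ_pairs S \<and> \<xi> = \<eta> \<and>
     (\<exists>e \<in> carrier (idem S). \<xi> e = 1 \<and> s \<otimes>\<^bsub>S\<^esub> e = t \<otimes>\<^bsub>S\<^esub> e)}"

definition germ :: "'a sgrp \<Rightarrow> 'a \<Rightarrow> ('a \<Rightarrow> nat) \<Rightarrow> ('a \<times> ('a \<Rightarrow> nat)) set" where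
  "germ S s \<xi> = germ_rel S `` {(s, \<xi>)}"

text \<open>The unit \<open>[e, \<xi>]\<close> of a character \<open>\<xi>\<close>. The classes in the union coincide for all
  idempotents \<open>e\<close> with \<open>\<xi> e = 1\<close>; the unions in the definition of the groupoid are likewise
  over representatives of one class.\<close>

definition unit_germ :: "'a sgrp \<Rightarrow> ('a \<Rightarrow> nat) \<Rightarrow> ('a \<times> ('a \<Rightarrow> nat)) set" where
  "unit_germ S \<xi> = (\<Union>e \<in> {e \<in> carrier (idem S). \<xi> e = 1}. germ S e \<xi>)"

definition basic_sets :: "'a sgrp \<Rightarrow> ('a \<times> ('a \<Rightarrow> nat)) set set set" where
  "basic_sets S = {germ S s ` U | s U. s \<in> carrier S \<and>
     openin (character_space (idem S)) U \<and> U \<subseteq> D_set S (star S s \<otimes>\<^bsub>S\<^esub> s)}"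

text \<open>The basic sets form a basis, so the topology they generate consists of their unions.\<close>

definition universal_groupoid :: "'a sgrp \<Rightarrow> ('a \<times> ('a \<Rightarrow> nat)) set tgroupoid" where
  "universal_groupoid S =
     \<lparr>arr_top = topology_generated_by (basic_sets S),
      gdom = (\<lambda>a. \<Union>(s, \<xi>) \<in> a. unit_germ S \<xi>),
      grng = (\<lambda>a. \<Union>(s, \<xi>) \<in> a. unit_germ S (beta S s \<xi>)),
      gcomp = (\<lambda>a b. \<Union>(s, \<eta>) \<in> a. \<Union>(t, \<xi>) \<in> b. germ S (s \<otimes>\<^bsub>S\<^esub> t) \<xi>),
      ginv = (\<lambda>a. \<Union>(s, \<xi>) \<in> a. germ S (star S s) (beta S s \<xi>))\<rparr>"

lemma (in inverse_semigroup) star_props: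
  assumes "s \<in> carrier S"
  shows "star S s \<in> carrier S" "s \<otimes> star S s \<otimes> s = s" "star S s \<otimes> s \<otimes> star S s = star S s"
  using theI'[OF ex1_star[OF assms]] unfolding star_def by metis+

lemma (in inverse_semigroup) star_mult_idem:
  assumes "s \<in> carrier S"
  shows "star S s \<otimes> s \<in> carrier (idem S)"
  using star_props[OF assms] assms by (simp add: idem_def closed assoc[symmetric])

lemma openin_D_set:
  assumes "e \<in> carrier (idem S)"
  shows "openin (character_space (idem S)) (D_set S e)"
proof -
  let ?P = "product_topology (\<lambda>_. discrete_topology {0, 1 :: nat}) (carrier (idem S))"
  have "openin ?P {\<xi> \<in> topspace ?P. \<xi> e \<in> {1}}"
    using continuous_map_product_projection[OF assms, of "\<lambda>_. discrete_topology {0, 1 :: nat}"]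
    by (rule openin_continuous_map_preimage) simp
  moreover have "D_set S e = {\<xi> \<in> topspace ?P. \<xi> e \<in> {1}} \<inter> characters (idem S)"
    by (auto simp: D_set_def characters_def)
  ultimately show ?thesis
    unfolding character_space_def openin_subtopology by blast
qed

lemma (in inverse_semigroup) arrows_universal_groupoid:
  "arrows (universal_groupoid S) = germ_pairs S // germ_rel S"
proof -
  have "\<Union>(basic_sets S) = (\<Union>s\<in>carrier S. germ S s ` D_set S (star S s \<otimes> s))"
    unfolding basic_sets_def using openin_D_set[OF star_mult_idem] by blast
  also have "\<dots> = germ_pairs S // germ_rel S"
    by (auto simp: quotient_def germ_def germ_pairs_def)
  finally show ?thesis
    by (simp add: universal_groupoid_def)
qed

end

theory Submission
  imports Defs
begin

text \<open>The quotient map identifies \<open>E(S/\<nu>)\<close> with \<open>E(S)/\<rho>\<close>, so pulling characters back along it is a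
  homeomorphism of the character space of \<open>E(S/\<nu>)\<close> onto \<open>F\<^sub>\<rho>\<close>. The isomorphism sends the germ of the
  class of \<open>s\<close> at \<open>\<xi>\<close> to the germ of \<open>s\<close> at the pullback of \<open>\<xi>\<close>. It is well defined and injective
  because if \<open>s e\<close> and \<open>t e\<close> are \<open>\<nu>\<close>-related, then \<open>s e f = t e f\<close> for an idempotent \<open>f\<close> related to
  \<open>(s e)\<^sup>* (s e)\<close>, and the pullback takes the value 1 at \<open>f\<close> as soon as it does at \<open>e\<close> and \<open>s\<^sup>* s\<close>.\<close>

section \<open>Inverse semigroups\<close>

text \<open>The idempotents of S/\<nu> and the elements of E(S)/\<rho> correspond without being the
  same sets. A class of \<nu> that contains an idempotent may contain other elements as well, and an
  idempotent of the quotient is a priori only the class of some s with \<open>s s\<close> related to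
  s. The first point is settled by intersecting with E(S), where \<nu> restricts to \<rho>; the
  second by regularity of S. Uniqueness of inverses does not pass to a quotient by itself. It is
  recovered from commuting idempotents, and commutation in S is in turn derived from uniqueness of
  inverses. The groupoid operations are unions over representatives, so each needs its own
  independence proof. The pattern is always the same: two representatives agree after multiplication
  by an idempotent at which the character is 1, and this idempotent has to be transported through
  the operation. The reduction carries the relative topology, so openness of the isomorphism rests
  on extending an open set of pulled-back characters to an open set of characters of E(S).\<close>

lemma mult_idem [simp]: "mult (idem S) = mult S"
  by (simp add: idem_def)

lemma idem_iff: "e \<in> carrier (idem S) \<longleftrightarrow> e \<in> carrier S \<and> e \<otimes>\<^bsub>S\<^esub> e = e"
  by (auto simp: idem_def)

lemma UN_const_eq:
  assumes "x \<in> A" "\<And>y. y \<in> A \<Longrightarrow> f y = f x"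
  shows "(\<Union>y\<in>A. f y) = f x"
  using assms by blast

lemma arr_top_reduction:
  "arr_top (reduction G F) = subtopology (arr_top G) {a \<in> arrows G. gdom G a \<in> F}"
  by (simp add: reduction_def)

context inverse_semigroup
begin

abbreviation star_syntax ("_\<^sup>\<star>" [1000] 1000) where "s\<^sup>\<star> \<equiv> star S s"
abbreviation "E \<equiv> carrier (idem S)"

lemma star_eqI:
  assumes "s \<in> carrier S" "t \<in> carrier S" "s \<otimes> t \<otimes> s = s" "t \<otimes> s \<otimes> t = t"
  shows "s\<^sup>\<star> = t"
  using ex1_star[OF assms(1)] star_props[OF assms(1)] assms by metis

lemma idem_closed [simp]: "e \<in> E \<Longrightarrow> e \<in> carrier S"
  by (simp add: idem_iff)

lemma idem_idem [simp]: "e \<in> E \<Longrightarrow> e \<otimes> e = e"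
  by (simp add: idem_iff)

lemmas star_closed [simp] = star_props(1)
declare closed [simp]

lemma idem_idem_left [simp]: "\<lbrakk>e \<in> E; x \<in> carrier S\<rbrakk> \<Longrightarrow> e \<otimes> (e \<otimes> x) = e \<otimes> x"
  using assoc[of e e x] by simp

lemma star_mult [simp]:
  assumes "s \<in> carrier S"
  shows "s \<otimes> (s\<^sup>\<star> \<otimes> s) = s" "s\<^sup>\<star> \<otimes> (s \<otimes> s\<^sup>\<star>) = s\<^sup>\<star>"
  using star_props[OF assms] assms by (simp_all add: assoc)

lemma star_mult_left [simp]:
  assumes "s \<in> carrier S" "x \<in> carrier S"
  shows "s \<otimes> (s\<^sup>\<star> \<otimes> (s \<otimes> x)) = s \<otimes> x" "s\<^sup>\<star> \<otimes> (s \<otimes> (s\<^sup>\<star> \<otimes> x)) = s\<^sup>\<star> \<otimes> x"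
  using star_props(2,3)[OF assms(1)] assms by (metis assoc closed star_closed)+

lemma star_star [simp]: "s \<in> carrier S \<Longrightarrow> s\<^sup>\<star>\<^sup>\<star> = s"
  by (rule star_eqI) (simp_all add: assoc)

lemma star_idem [simp]: "e \<in> E \<Longrightarrow> e\<^sup>\<star> = e"
  by (rule star_eqI) (simp_all add: assoc)

text \<open>If x is the inverse of \<open>e f\<close>, then \<open>f x e\<close> is another inverse
  of \<open>e f\<close>, so it equals x. But \<open>f x e\<close> is idempotent because
  \<open>x e f x = x\<close>. Hence x is idempotent and its own inverse, which makes it equal to
  \<open>e f\<close>.\<close>

lemma idem_mult_closed [simp]:
  assumes e: "e \<in> E" and f: "f \<in> E"
  shows "e \<otimes> f \<in> E"
proof -
  let ?x = "(e \<otimes> f)\<^sup>\<star>"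
  have c [simp]: "?x \<in> carrier S" using e f by simp
  have 1: "e \<otimes> (f \<otimes> (?x \<otimes> (e \<otimes> f))) = e \<otimes> f"
    and 2: "?x \<otimes> (e \<otimes> (f \<otimes> ?x)) = ?x"
    using star_props(2,3)[of "e \<otimes> f"] e f by (simp_all add: assoc del: star_mult)
  have 3: "?x \<otimes> (e \<otimes> (f \<otimes> (?x \<otimes> e))) = ?x \<otimes> e"
    using star_mult_left(2)[of "e \<otimes> f" e] e f by (simp add: assoc del: star_mult_left)
  have x: "?x = f \<otimes> ?x \<otimes> e"
    by (rule star_eqI) (use e f 1 2 3 in \<open>simp_all add: assoc\<close>)
  have "(f \<otimes> ?x \<otimes> e) \<otimes> (f \<otimes> ?x \<otimes> e) = f \<otimes> ?x \<otimes> e"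
    using e f 3 by (simp add: assoc)
  then have "?x \<in> E"
    unfolding idem_iff using x c by metis
  then show ?thesis
    using star_idem[of ?x] star_star[of "e \<otimes> f"] e f by simp
qed

text \<open>Since \<open>e f\<close> and \<open>f e\<close> are idempotent, \<open>f e\<close> is an
  inverse of \<open>e f\<close>; but an idempotent is its own inverse.\<close>

lemma idem_commute:
  assumes e: "e \<in> E" and f: "f \<in> E"
  shows "e \<otimes> f = f \<otimes> e"
proof -
  have "e \<otimes> (f \<otimes> (e \<otimes> f)) = e \<otimes> f" "f \<otimes> (e \<otimes> (f \<otimes> e)) = f \<otimes> e"
    using idem_idem[OF idem_mult_closed, of e f] idem_idem[OF idem_mult_closed, of f e] e f
    by (simp_all add: assoc del: idem_idem)
  then have "(e \<otimes> f)\<^sup>\<star> = f \<otimes> e"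
    using e f by (intro star_eqI) (simp_all add: assoc)
  then show ?thesis
    using e f by simp
qed

lemma idem_left_commute:
  "\<lbrakk>e \<in> E; f \<in> E; x \<in> carrier S\<rbrakk> \<Longrightarrow> e \<otimes> (f \<otimes> x) = f \<otimes> (e \<otimes> x)"
  using idem_commute[of e f] assoc[of e f x] assoc[of f e x] by simp

lemma star_mult_idems [simp]:
  assumes "s \<in> carrier S"
  shows "s\<^sup>\<star> \<otimes> s \<in> E" "s \<otimes> s\<^sup>\<star> \<in> E"
  unfolding idem_iff using assms by (simp_all add: assoc)

text \<open>Together with \<open>assoc\<close>, rewriting with these rules moves idempotents to the left past
  \<open>s\<^sup>\<star> \<otimes> s\<close> and \<open>s \<otimes> s\<^sup>\<star>\<close>, where the adjacent factors then cancel.\<close>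

lemma star_mult_commute:
  assumes "s \<in> carrier S" "e \<in> E"
  shows "s\<^sup>\<star> \<otimes> (s \<otimes> e) = e \<otimes> (s\<^sup>\<star> \<otimes> s)" "s \<otimes> (s\<^sup>\<star> \<otimes> e) = e \<otimes> (s \<otimes> s\<^sup>\<star>)"
  using idem_commute[of "s\<^sup>\<star> \<otimes> s" e] idem_commute[of "s \<otimes> s\<^sup>\<star>" e] assms
  by (simp_all add: assoc)

lemma star_mult_left_commute:
  assumes "s \<in> carrier S" "e \<in> E" "x \<in> carrier S"
  shows "s\<^sup>\<star> \<otimes> (s \<otimes> (e \<otimes> x)) = e \<otimes> (s\<^sup>\<star> \<otimes> (s \<otimes> x))"
    "s \<otimes> (s\<^sup>\<star> \<otimes> (e \<otimes> x)) = e \<otimes> (s \<otimes> (s\<^sup>\<star> \<otimes> x))"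
  using idem_left_commute[of "s\<^sup>\<star> \<otimes> s" e x] idem_left_commute[of "s \<otimes> s\<^sup>\<star>" e x] assms
  by (simp_all add: assoc)

lemmas star_commutes = star_mult_commute star_mult_left_commute

lemma star_mult_distrib [simp]:
  assumes s: "s \<in> carrier S" and t: "t \<in> carrier S"
  shows "(s \<otimes> t)\<^sup>\<star> = t\<^sup>\<star> \<otimes> s\<^sup>\<star>"
proof (rule star_eqI)
  have c: "(s\<^sup>\<star> \<otimes> s) \<otimes> (t \<otimes> t\<^sup>\<star>) = (t \<otimes> t\<^sup>\<star>) \<otimes> (s\<^sup>\<star> \<otimes> s)"
    using s t by (intro idem_commute) simp_all
  have "s \<otimes> t \<otimes> (t\<^sup>\<star> \<otimes> s\<^sup>\<star>) \<otimes> (s \<otimes> t) = s \<otimes> ((t \<otimes> t\<^sup>\<star>) \<otimes> (s\<^sup>\<star> \<otimes> s)) \<otimes> t"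
    using s t by (simp add: assoc)
  also have "\<dots> = s \<otimes> t"
    unfolding c[symmetric] using s t by (simp add: assoc)
  finally show "s \<otimes> t \<otimes> (t\<^sup>\<star> \<otimes> s\<^sup>\<star>) \<otimes> (s \<otimes> t) = s \<otimes> t" .
  have "t\<^sup>\<star> \<otimes> s\<^sup>\<star> \<otimes> (s \<otimes> t) \<otimes> (t\<^sup>\<star> \<otimes> s\<^sup>\<star>) = t\<^sup>\<star> \<otimes> ((s\<^sup>\<star> \<otimes> s) \<otimes> (t \<otimes> t\<^sup>\<star>)) \<otimes> s\<^sup>\<star>"
    using s t by (simp add: assoc)
  also have "\<dots> = t\<^sup>\<star> \<otimes> s\<^sup>\<star>"
    unfolding c using s t by (simp add: assoc)
  finally show "t\<^sup>\<star> \<otimes> s\<^sup>\<star> \<otimes> (s \<otimes> t) \<otimes> (t\<^sup>\<star> \<otimes> s\<^sup>\<star>) = t\<^sup>\<star> \<otimes> s\<^sup>\<star>" .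
qed (use s t in simp_all)

lemma conj_idem [simp]:
  assumes "s \<in> carrier S" "e \<in> E"
  shows "s\<^sup>\<star> \<otimes> (e \<otimes> s) \<in> E" "s \<otimes> (e \<otimes> s\<^sup>\<star>) \<in> E"
proof -
  have "s\<^sup>\<star> \<otimes> (e \<otimes> s) \<otimes> (s\<^sup>\<star> \<otimes> (e \<otimes> s)) = s\<^sup>\<star> \<otimes> (e \<otimes> s)"
    "s \<otimes> (e \<otimes> s\<^sup>\<star>) \<otimes> (s \<otimes> (e \<otimes> s\<^sup>\<star>)) = s \<otimes> (e \<otimes> s\<^sup>\<star>)"
    using assms by (simp_all add: assoc star_commutes)
  moreover have "s\<^sup>\<star> \<otimes> (e \<otimes> s) \<in> carrier S" "s \<otimes> (e \<otimes> s\<^sup>\<star>) \<in> carrier S"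
    using assms by simp_all
  ultimately show "s\<^sup>\<star> \<otimes> (e \<otimes> s) \<in> E" "s \<otimes> (e \<otimes> s\<^sup>\<star>) \<in> E"
    unfolding idem_iff by blast+
qed

section \<open>Germs\<close>

lemma charD:
  assumes "\<xi> \<in> characters (idem S)"
  shows "\<lbrakk>e \<in> E; f \<in> E\<rbrakk> \<Longrightarrow> \<xi> (e \<otimes> f) = \<xi> e * \<xi> f" "e \<in> E \<Longrightarrow> \<xi> e = 0 \<or> \<xi> e = 1"
    "\<exists>e\<in>E. \<xi> e = 1"
  using assms by (fastforce simp: characters_def)+

lemma germ_pairs_iff:
  "(s, \<xi>) \<in> germ_pairs S \<longleftrightarrow> s \<in> carrier S \<and> \<xi> \<in> characters (idem S) \<and> \<xi> (s\<^sup>\<star> \<otimes> s) = 1"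
  by (simp add: germ_pairs_def D_set_def)

lemma germ_pairs_iff_D_set:
  "(s, \<xi>) \<in> germ_pairs S \<longleftrightarrow> s \<in> carrier S \<and> \<xi> \<in> D_set S (s\<^sup>\<star> \<otimes> s)"
  by (simp add: germ_pairs_def)

lemma equiv_germ_rel: "equiv (germ_pairs S) (germ_rel S)"
proof (rule equivI)
  show "germ_rel S \<subseteq> germ_pairs S \<times> germ_pairs S"
    by (auto simp: germ_rel_def)
  show "refl_on (germ_pairs S) (germ_rel S)"
    by (auto simp: refl_on_def germ_rel_def germ_pairs_iff intro!: bexI[of _ "star S _ \<otimes> _"])
  show "sym (germ_rel S)"
    by (rule symI) (auto simp: germ_rel_def)
  show "trans (germ_rel S)"
  proof (rule transI, clarsimp simp: germ_rel_def)
    fix s t u e f and \<xi> :: "'a \<Rightarrow> nat"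
    assume *: "(s, \<xi>) \<in> germ_pairs S" "(t, \<xi>) \<in> germ_pairs S" "(u, \<xi>) \<in> germ_pairs S"
      and ef: "e \<in> E" "f \<in> E" and 1: "\<xi> e = Suc 0" "\<xi> f = Suc 0"
      and eq: "s \<otimes> e = t \<otimes> e" "t \<otimes> f = u \<otimes> f"
    have c: "s \<in> carrier S" "t \<in> carrier S" "u \<in> carrier S" "\<xi> \<in> characters (idem S)"
      using * by (auto simp: germ_pairs_iff)
    have "s \<otimes> (e \<otimes> f) = t \<otimes> (f \<otimes> e)"
      using eq c ef by (simp add: assoc[symmetric] idem_commute[of f e])
    also have "\<dots> = u \<otimes> (e \<otimes> f)"
      using eq c ef by (simp add: assoc[symmetric] idem_commute[of e f])
    finally show "\<exists>e\<in>E. \<xi> e = Suc 0 \<and> s \<otimes> e = u \<otimes> e"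
      using ef 1 c by (intro bexI[of _ "e \<otimes> f"]) (simp_all add: charD)
  qed
qed

lemma germ_eq_iff:
  assumes "(s, \<xi>) \<in> germ_pairs S" "(t, \<eta>) \<in> germ_pairs S"
  shows "germ S s \<xi> = germ S t \<eta> \<longleftrightarrow> \<xi> = \<eta> \<and> (\<exists>e\<in>E. \<xi> e = 1 \<and> s \<otimes> e = t \<otimes> e)"
  unfolding germ_def eq_equiv_class_iff[OF equiv_germ_rel assms]
  using assms by (auto simp: germ_rel_def)

lemma in_germ_iff:
  assumes "(s, \<xi>) \<in> germ_pairs S"
  shows "(t, \<eta>) \<in> germ S s \<xi> \<longleftrightarrow>
    (t, \<eta>) \<in> germ_pairs S \<and> \<xi> = \<eta> \<and> (\<exists>e\<in>E. \<xi> e = 1 \<and> s \<otimes> e = t \<otimes> e)"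
  using assms by (auto simp: germ_def germ_rel_def)

lemma self_in_germ: "(s, \<xi>) \<in> germ_pairs S \<Longrightarrow> (s, \<xi>) \<in> germ S s \<xi>"
  unfolding germ_def by (rule equiv_class_self[OF equiv_germ_rel])

text \<open>The tool for evaluating the structure maps: a union over the members of a germ collapses
  to one term once any representative agreeing with s on a suitable idempotent gives the same
  value.\<close>

lemma UN_germ:
  assumes "(s, \<xi>) \<in> germ_pairs S"
    and "\<And>t e. \<lbrakk>(t, \<xi>) \<in> germ_pairs S; e \<in> E; \<xi> e = 1; s \<otimes> e = t \<otimes> e\<rbrakk> \<Longrightarrow> f t \<xi> = f s \<xi>"
  shows "(\<Union>(t, \<eta>)\<in>germ S s \<xi>. f t \<eta>) = f s \<xi>"
proof -
  have "(\<Union>(t, \<eta>)\<in>germ S s \<xi>. f t \<eta>) = (case (s, \<xi>) of (t, \<eta>) \<Rightarrow> f t \<eta>)"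
  proof (rule UN_const_eq[OF self_in_germ[OF assms(1)]])
    fix p assume *: "p \<in> germ S s \<xi>"
    obtain t \<eta> where p: "p = (t, \<eta>)"
      by (cases p)
    obtain e where e: "(t, \<xi>) \<in> germ_pairs S" "e \<in> E" "\<xi> e = 1" "s \<otimes> e = t \<otimes> e" and "\<eta> = \<xi>"
      using * unfolding p in_germ_iff[OF assms(1)] by blast
    then show "(case p of (t, \<eta>) \<Rightarrow> f t \<eta>) = (case (s, \<xi>) of (t, \<eta>) \<Rightarrow> f t \<eta>)"
      unfolding p prod.case using assms(2)[OF e] by simp
  qed
  then show ?thesis
    by simp
qed

lemma unit_germ_eq:
  assumes "\<xi> \<in> characters (idem S)" "e \<in> E" "\<xi> e = 1"
  shows "unit_germ S \<xi> = germ S e \<xi>"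
  unfolding unit_germ_def
proof (rule UN_const_eq)
  fix f assume f: "f \<in> {e \<in> E. \<xi> e = 1}"
  have "f \<otimes> (e \<otimes> f) = e \<otimes> (e \<otimes> f)"
    using f assms by (simp add: idem_left_commute)
  then have "\<exists>g\<in>E. \<xi> g = 1 \<and> f \<otimes> g = e \<otimes> g"
    using f assms by (intro bexI[of _ "e \<otimes> f"]) (simp_all add: charD)
  then show "germ S f \<xi> = germ S e \<xi>"
    using f assms by (simp add: germ_eq_iff germ_pairs_iff)
qed (use assms in simp)

lemma unit_germ_inj:
  assumes "\<xi> \<in> characters (idem S)" "\<eta> \<in> characters (idem S)" "unit_germ S \<xi> = unit_germ S \<eta>"
  shows "\<xi> = \<eta>"
proof -
  obtain e f where "e \<in> E" "\<xi> e = 1" "f \<in> E" "\<eta> f = 1"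
    using charD(3) assms by metis
  then show ?thesis
    using assms by (simp add: unit_germ_eq germ_eq_iff germ_pairs_iff)
qed

lemma beta_apply: "\<lbrakk>s \<in> carrier S; e \<in> E\<rbrakk> \<Longrightarrow> beta S s \<xi> e = \<xi> (s\<^sup>\<star> \<otimes> (e \<otimes> s))"
  by (simp add: beta_def assoc)

lemma beta_character:
  assumes "(s, \<xi>) \<in> germ_pairs S"
  shows "beta S s \<xi> \<in> characters (idem S)" "beta S s \<xi> (s \<otimes> s\<^sup>\<star>) = 1"
proof -
  have s: "s \<in> carrier S" and \<xi>: "\<xi> \<in> characters (idem S)" and 1: "\<xi> (s\<^sup>\<star> \<otimes> s) = 1"
    using assms by (auto simp: germ_pairs_iff)
  show *: "beta S s \<xi> (s \<otimes> s\<^sup>\<star>) = 1"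
    using s 1 by (simp add: beta_apply assoc)
  have "beta S s \<xi> (e \<otimes> f) = beta S s \<xi> e * beta S s \<xi> f" if "e \<in> E" "f \<in> E" for e f
  proof -
    \<comment> \<open>The factor \<open>s s\<^sup>\<star>\<close> that appears between e and f
      commutes with f and is absorbed by the final s.\<close>
    have "s\<^sup>\<star> \<otimes> ((e \<otimes> f) \<otimes> s) = (s\<^sup>\<star> \<otimes> (e \<otimes> s)) \<otimes> (s\<^sup>\<star> \<otimes> (f \<otimes> s))"
      using s that by (simp add: assoc star_commutes)
    then show ?thesis
      using s that charD(1)[OF \<xi>, of "s\<^sup>\<star> \<otimes> (e \<otimes> s)" "s\<^sup>\<star> \<otimes> (f \<otimes> s)"]
      by (simp add: beta_apply)
  qed
  moreover have "beta S s \<xi> \<in> E \<rightarrow>\<^sub>E {0, 1}"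
  proof (rule PiE_I)
    show "beta S s \<xi> e \<in> {0, 1}" if "e \<in> E" for e
      using s that charD(2)[OF \<xi>, of "s\<^sup>\<star> \<otimes> (e \<otimes> s)"] by (simp add: beta_apply)
  qed (simp add: beta_def)
  ultimately show "beta S s \<xi> \<in> characters (idem S)"
    using * s unfolding characters_def by (auto intro!: bexI[of _ "s \<otimes> s\<^sup>\<star>"])
qed

text \<open>Replacing u by \<open>u e\<close> multiplies \<open>u\<^sup>\<star> f u\<close> by e on
  both sides, which \<xi> does not notice because its value at e is 1. So \<open>beta\<close>
  depends only on \<open>s e\<close>.\<close>

lemma beta_cong:
  assumes "(s, \<xi>) \<in> germ_pairs S" "(t, \<xi>) \<in> germ_pairs S" "e \<in> E" "\<xi> e = 1" "s \<otimes> e = t \<otimes> e"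
  shows "beta S s \<xi> = beta S t \<xi>"
proof -
  have c: "s \<in> carrier S" "t \<in> carrier S" and \<xi>: "\<xi> \<in> characters (idem S)"
    using assms by (auto simp: germ_pairs_iff)
  have *: "\<xi> (u\<^sup>\<star> \<otimes> (f \<otimes> u)) = \<xi> ((u \<otimes> e)\<^sup>\<star> \<otimes> (f \<otimes> (u \<otimes> e)))"
    if "u \<in> carrier S" "f \<in> E" for u f
  proof -
    have "(u \<otimes> e)\<^sup>\<star> \<otimes> (f \<otimes> (u \<otimes> e)) = e \<otimes> (u\<^sup>\<star> \<otimes> (f \<otimes> u) \<otimes> e)"
      using that assms by (simp add: assoc)
    then show ?thesis
      using that assms \<xi> by (simp add: charD)
  qed
  have "\<xi> (s\<^sup>\<star> \<otimes> (f \<otimes> s)) = \<xi> (t\<^sup>\<star> \<otimes> (f \<otimes> t))" if "f \<in> E" for f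
    using *[of s f] *[of t f] that c assms(5) by simp
  then show ?thesis
    using c by (auto simp: beta_def assoc)
qed

section \<open>The structure maps evaluated on germs\<close>

lemma gdom_germ:
  assumes "(s, \<xi>) \<in> germ_pairs S"
  shows "gdom (universal_groupoid S) (germ S s \<xi>) = unit_germ S \<xi>"
  using UN_germ[OF assms, of "\<lambda>t. unit_germ S"] by (simp add: universal_groupoid_def)

lemma grng_germ:
  assumes "(s, \<xi>) \<in> germ_pairs S"
  shows "grng (universal_groupoid S) (germ S s \<xi>) = unit_germ S (beta S s \<xi>)"
  using UN_germ[OF assms, of "\<lambda>t \<xi>. unit_germ S (beta S t \<xi>)"] beta_cong[OF assms]
  by (simp add: universal_groupoid_def)

lemma star_germ_pairs:
  assumes "(s, \<xi>) \<in> germ_pairs S"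
  shows "(s\<^sup>\<star>, beta S s \<xi>) \<in> germ_pairs S"
  using beta_character[OF assms] assms by (simp add: germ_pairs_iff)

lemma ginv_germ:
  assumes "(s, \<xi>) \<in> germ_pairs S"
  shows "ginv (universal_groupoid S) (germ S s \<xi>) = germ S (s\<^sup>\<star>) (beta S s \<xi>)"
proof -
  have "(\<Union>(s, \<xi>)\<in>germ S s \<xi>. germ S (s\<^sup>\<star>) (beta S s \<xi>)) = germ S (s\<^sup>\<star>) (beta S s \<xi>)"
  proof (rule UN_germ[OF assms])
    fix t e assume t: "(t, \<xi>) \<in> germ_pairs S" and e: "e \<in> E" "\<xi> e = 1" and eq: "s \<otimes> e = t \<otimes> e"
    have c: "s \<in> carrier S" "t \<in> carrier S" and \<xi>: "\<xi> \<in> characters (idem S)"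
      and 1: "\<xi> (s\<^sup>\<star> \<otimes> s) = 1" "\<xi> (t\<^sup>\<star> \<otimes> t) = 1"
      using assms t by (auto simp: germ_pairs_iff)
    have b: "beta S s \<xi> = beta S t \<xi>"
      by (rule beta_cong[OF assms t e eq])
    \<comment> \<open>Applying the involution to \<open>s e = t e\<close> gives an equation with e
      on the left, while germs compare products with an idempotent on the right. Conjugating e by s
      moves it across: \<open>s\<^sup>\<star> ?f = e s\<^sup>\<star>\<close>.\<close>
    let ?f = "s \<otimes> (e \<otimes> s\<^sup>\<star>)"
    have star_eq: "e \<otimes> s\<^sup>\<star> = e \<otimes> t\<^sup>\<star>"
      using arg_cong[OF eq, of "star S"] c e by simp
    have f: "?f = t \<otimes> (e \<otimes> t\<^sup>\<star>)"
      using c e eq star_eq by (metis assoc idem_closed star_closed)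
    have "s\<^sup>\<star> \<otimes> ?f = e \<otimes> s\<^sup>\<star>"
      using c e by (simp add: star_commutes)
    moreover have "t\<^sup>\<star> \<otimes> ?f = e \<otimes> t\<^sup>\<star>"
      unfolding f using c e by (simp add: star_commutes)
    moreover have "beta S s \<xi> ?f = \<xi> (e \<otimes> (s\<^sup>\<star> \<otimes> s))"
      using c e by (simp add: beta_apply assoc star_commutes)
    then have "beta S s \<xi> ?f = 1"
      using c e 1 \<xi> by (simp add: charD)
    moreover have "?f \<in> E"
      using c e by simp
    ultimately show "germ S (t\<^sup>\<star>) (beta S t \<xi>) = germ S (s\<^sup>\<star>) (beta S s \<xi>)"
      unfolding germ_eq_iff[OF star_germ_pairs[OF t] star_germ_pairs[OF assms]]
      using b star_eq by metis
  qed
  then show ?thesis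
    by (simp add: universal_groupoid_def)
qed

lemma mult_germ_pairs:
  assumes "(s, beta S t \<xi>) \<in> germ_pairs S" "(t, \<xi>) \<in> germ_pairs S"
  shows "(s \<otimes> t, \<xi>) \<in> germ_pairs S"
proof -
  have "s \<in> carrier S" "t \<in> carrier S" "\<xi> \<in> characters (idem S)" "beta S t \<xi> (s\<^sup>\<star> \<otimes> s) = 1"
    using assms by (auto simp: germ_pairs_iff)
  then show ?thesis
    by (simp add: germ_pairs_iff beta_apply assoc)
qed

lemma gcomp_germ:
  assumes "(s, beta S t \<xi>) \<in> germ_pairs S" "(t, \<xi>) \<in> germ_pairs S"
  shows "gcomp (universal_groupoid S) (germ S s (beta S t \<xi>)) (germ S t \<xi>) = germ S (s \<otimes> t) \<xi>"
proof -
  let ?\<eta> = "beta S t \<xi>"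
  have key: "germ S (s' \<otimes> t') \<xi> = germ S (s \<otimes> t) \<xi>"
    if s': "(s', ?\<eta>) \<in> germ_pairs S" and f: "f \<in> E" "?\<eta> f = 1" "s \<otimes> f = s' \<otimes> f"
      and t': "(t', \<xi>) \<in> germ_pairs S" and e: "e \<in> E" "\<xi> e = 1" "t \<otimes> e = t' \<otimes> e" for s' t' e f
  proof -
    have c: "s \<in> carrier S" "t \<in> carrier S" "s' \<in> carrier S" "t' \<in> carrier S"
      and \<xi>: "\<xi> \<in> characters (idem S)"
      using assms s' t' by (auto simp: germ_pairs_iff)
    have b: "?\<eta> = beta S t' \<xi>"
      by (rule beta_cong[OF assms(2) t' e])
    \<comment> \<open>\<open>?h\<close> carries f through t: \<open>t ?h = f t\<close>, and \<xi> at
      \<open>?h\<close> is \<open>?\<eta> f = 1\<close> by the definition of \<open>beta\<close>.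
      Multiplying by e also makes t and t' agree, so \<open>?g\<close> handles both changes of
      representative at once.\<close>
    let ?h = "t\<^sup>\<star> \<otimes> (f \<otimes> t)"
    let ?g = "e \<otimes> ?h"
    have tg: "t \<otimes> ?g = f \<otimes> (t \<otimes> e)"
    proof -
      have "t \<otimes> ?g = t \<otimes> (?h \<otimes> e)"
        using c e(1) f(1) by (simp add: idem_commute[of e ?h])
      also have "\<dots> = f \<otimes> (t \<otimes> e)"
        using c e(1) f(1) by (simp add: assoc star_mult_left_commute)
      finally show ?thesis .
    qed
    have "t' \<otimes> ?g = t' \<otimes> e \<otimes> ?h"
      using c e(1) f(1) by (simp add: assoc)
    also have "\<dots> = t \<otimes> e \<otimes> ?h"
      by (simp only: e(3))
    also have "\<dots> = t \<otimes> ?g"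
      using c e(1) f(1) by (simp add: assoc)
    finally have t'g: "t' \<otimes> ?g = t \<otimes> ?g" .
    have "s' \<otimes> t' \<otimes> ?g = s' \<otimes> f \<otimes> (t \<otimes> e)"
      using c e(1) f(1) t'g tg by (simp add: assoc)
    also have "\<dots> = s \<otimes> f \<otimes> (t \<otimes> e)"
      using f(3) by simp
    also have "\<dots> = s \<otimes> t \<otimes> ?g"
      using c e(1) f(1) tg by (simp add: assoc)
    finally have "s' \<otimes> t' \<otimes> ?g = s \<otimes> t \<otimes> ?g" .
    moreover have "\<xi> ?g = 1"
      using c e(1,2) f(1,2) \<xi> by (simp add: charD beta_apply)
    moreover have "?g \<in> E"
      using c e(1) f(1) by simp
    ultimately show ?thesis
      unfolding germ_eq_iff[OF mult_germ_pairs[OF s'[unfolded b] t'] mult_germ_pairs[OF assms]]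
      by blast
  qed
  have "(\<Union>(s', \<eta>)\<in>germ S s ?\<eta>. \<Union>(t', \<zeta>)\<in>germ S t \<xi>. germ S (s' \<otimes> t') \<zeta>)
    = (\<Union>(t', \<zeta>)\<in>germ S t \<xi>. germ S (s \<otimes> t') \<zeta>)"
  \<comment> \<open>The outer union collapses because the inner unions for s' and s agree term by
    term: both terms equal the germ of \<open>s t\<close>.\<close>
  proof (rule UN_germ[OF assms(1)])
    fix s' f assume s': "(s', ?\<eta>) \<in> germ_pairs S" "f \<in> E" "?\<eta> f = 1" "s \<otimes> f = s' \<otimes> f"
    show "(\<Union>(t', \<zeta>)\<in>germ S t \<xi>. germ S (s' \<otimes> t') \<zeta>)
      = (\<Union>(t', \<zeta>)\<in>germ S t \<xi>. germ S (s \<otimes> t') \<zeta>)"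
    proof (rule SUP_cong[OF refl], clarify)
      fix t' \<zeta> assume "(t', \<zeta>) \<in> germ S t \<xi>"
      then obtain e where t': "(t', \<xi>) \<in> germ_pairs S" "\<zeta> = \<xi>" "e \<in> E" "\<xi> e = 1" "t \<otimes> e = t' \<otimes> e"
        unfolding in_germ_iff[OF assms(2)] by blast
      show "germ S (s' \<otimes> t') \<zeta> = germ S (s \<otimes> t') \<zeta>"
        unfolding t'(2) key[OF s' t'(1,3,4,5)] key[OF assms(1) s'(2,3) refl t'(1,3,4,5)] ..
    qed
  qed
  also have "\<dots> = germ S (s \<otimes> t) \<xi>"
  proof (rule UN_germ[OF assms(2)])
    fix t' e assume t': "(t', \<xi>) \<in> germ_pairs S" "e \<in> E" "\<xi> e = 1" "t \<otimes> e = t' \<otimes> e"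
    \<comment> \<open>Here s is not changed, but \<open>key\<close> still asks for an idempotent on
      which s agrees with itself; one exists because characters are nonzero.\<close>
    obtain f where "f \<in> E" "?\<eta> f = 1"
      using charD(3)[of ?\<eta>] assms(1) unfolding germ_pairs_iff by blast
    then show "germ S (s \<otimes> t') \<xi> = germ S (s \<otimes> t) \<xi>"
      by (rule key[OF assms(1) _ _ refl t'])
  qed
  finally show "gcomp (universal_groupoid S) (germ S s ?\<eta>) (germ S t \<xi>) = germ S (s \<otimes> t) \<xi>"
    unfolding universal_groupoid_def tgroupoid.select_convs .
qed

lemma arrowE:
  assumes "a \<in> arrows (universal_groupoid S)"
  obtains s \<xi> where "(s, \<xi>) \<in> germ_pairs S" "a = germ S s \<xi>"
  using assms unfolding arrows_universal_groupoid by (auto simp: germ_def elim!: quotientE)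

lemma germ_in_arrows: "(s, \<xi>) \<in> germ_pairs S \<Longrightarrow> germ S s \<xi> \<in> arrows (universal_groupoid S)"
  unfolding arrows_universal_groupoid germ_def by (rule quotientI)

lemma basic_setsI:
  "\<lbrakk>s \<in> carrier S; openin (character_space (idem S)) U; U \<subseteq> D_set S (s\<^sup>\<star> \<otimes> s)\<rbrakk>
   \<Longrightarrow> openin (arr_top (universal_groupoid S)) (germ S s ` U)"
  unfolding universal_groupoid_def basic_sets_def by (auto intro!: topology_generated_by_Basis)

lemma arr_top_universal_groupoid:
  "arr_top (universal_groupoid S) = topology_generated_by (basic_sets S)"
  by (simp add: universal_groupoid_def)

lemma basic_setsE:
  assumes "B \<in> basic_sets S"
  obtains s U where "s \<in> carrier S" "openin (character_space (idem S)) U"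
    "U \<subseteq> D_set S (s\<^sup>\<star> \<otimes> s)" "B = germ S s ` U"
proof -
  have "\<exists>s U. B = germ S s ` U \<and> s \<in> carrier S \<and> openin (character_space (idem S)) U \<and>
    U \<subseteq> D_set S (s\<^sup>\<star> \<otimes> s)"
    using assms unfolding basic_sets_def mem_Collect_eq .
  then show ?thesis
    by (elim exE conjE) (rule that)
qed

lemma topspace_character_space: "topspace (character_space (idem S)) = characters (idem S)"
  by (auto simp: character_space_def characters_def)

end

section \<open>The quotient by the minimum congruence\<close>

text \<open>Stated for any carrier because it serves both \<nu> on S and \<rho> on the idempotents.
  The two factors are changed one at a time.\<close>

lemma quot_sgrp_mult:
  assumes "sgrp_congruence R \<sigma>" "s \<in> carrier R" "t \<in> carrier R"
  shows "\<sigma> `` {s} \<otimes>\<^bsub>quot_sgrp R \<sigma>\<^esub> \<sigma> `` {t} = \<sigma> `` {s \<otimes>\<^bsub>R\<^esub> t}"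
proof -
  have eq: "equiv (carrier R) \<sigma>"
    and cong: "\<And>a b u. \<lbrakk>(a, b) \<in> \<sigma>; u \<in> carrier R\<rbrakk> \<Longrightarrow>
      (u \<otimes>\<^bsub>R\<^esub> a, u \<otimes>\<^bsub>R\<^esub> b) \<in> \<sigma> \<and> (a \<otimes>\<^bsub>R\<^esub> u, b \<otimes>\<^bsub>R\<^esub> u) \<in> \<sigma>"
    using assms(1) unfolding sgrp_congruence_def by auto
  have *: "\<sigma> `` {a \<otimes>\<^bsub>R\<^esub> b} = \<sigma> `` {s \<otimes>\<^bsub>R\<^esub> t}" if "a \<in> \<sigma> `` {s}" "b \<in> \<sigma> `` {t}" for a b
  proof -
    have ab: "(s, a) \<in> \<sigma>" "(t, b) \<in> \<sigma>" "a \<in> carrier R"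
      using that eq by (auto simp: equiv_def)
    have "(s \<otimes>\<^bsub>R\<^esub> t, a \<otimes>\<^bsub>R\<^esub> t) \<in> \<sigma>" "(a \<otimes>\<^bsub>R\<^esub> t, a \<otimes>\<^bsub>R\<^esub> b) \<in> \<sigma>"
      using cong ab assms(3) by auto
    then show ?thesis
      using equiv_class_eq[OF eq] by metis
  qed
  have "s \<in> \<sigma> `` {s}" "t \<in> \<sigma> `` {t}"
    using equiv_class_self[OF eq] assms by auto
  then have "(\<Union>a\<in>\<sigma> `` {s}. \<Union>b\<in>\<sigma> `` {t}. \<sigma> `` {a \<otimes>\<^bsub>R\<^esub> b}) = \<sigma> `` {s \<otimes>\<^bsub>R\<^esub> t}"
    using * by blast
  then show ?thesis
    by (simp add: quot_sgrp_def)
qed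

locale normal_idem_congruence = inverse_semigroup +
  fixes \<rho>
  assumes normal: "normal_congruence S \<rho>"
begin

abbreviation "\<nu> \<equiv> nu_min S \<rho>"
abbreviation "Q \<equiv> quot_sgrp S \<nu>"
abbreviation "cls s \<equiv> \<nu> `` {s}"

lemma rho_congruence: "sgrp_congruence (idem S) \<rho>"
  using normal by (simp add: normal_congruence_def)

lemma rho_equiv: "equiv E \<rho>"
  using rho_congruence by (simp add: sgrp_congruence_def)

lemma rho_in: "(e, f) \<in> \<rho> \<Longrightarrow> e \<in> E" "(e, f) \<in> \<rho> \<Longrightarrow> f \<in> E"
  using rho_equiv by (auto simp: equiv_def)

lemma rho_refl: "e \<in> E \<Longrightarrow> (e, e) \<in> \<rho>"
  using rho_equiv by (auto simp: equiv_def refl_on_def)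

lemma rho_sym: "(e, f) \<in> \<rho> \<Longrightarrow> (f, e) \<in> \<rho>"
  using rho_equiv by (auto simp: equiv_def sym_def)

lemma rho_trans: "\<lbrakk>(e, f) \<in> \<rho>; (f, g) \<in> \<rho>\<rbrakk> \<Longrightarrow> (e, g) \<in> \<rho>"
  using rho_equiv by (auto simp: equiv_def dest: transD)

lemma rho_mult:
  assumes "(e, f) \<in> \<rho>" "g \<in> E"
  shows "(g \<otimes> e, g \<otimes> f) \<in> \<rho>" "(e \<otimes> g, f \<otimes> g) \<in> \<rho>"
  using rho_congruence assms unfolding sgrp_congruence_def mult_idem by blast+

text \<open>Normality applied to \<open>s\<^sup>\<star>\<close>: this is the direction of
  conjugation that occurs in \<open>(s u)\<^sup>\<star> (s u)\<close>.\<close>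

lemma rho_conj:
  assumes "(e, f) \<in> \<rho>" "s \<in> carrier S"
  shows "(s\<^sup>\<star> \<otimes> (e \<otimes> s), s\<^sup>\<star> \<otimes> (f \<otimes> s)) \<in> \<rho>"
proof -
  have "(s\<^sup>\<star> \<otimes> e \<otimes> s\<^sup>\<star>\<^sup>\<star>, s\<^sup>\<star> \<otimes> f \<otimes> s\<^sup>\<star>\<^sup>\<star>) \<in> \<rho>"
    using normal assms star_closed[OF assms(2)] unfolding normal_congruence_def by blast
  then show ?thesis
    using assms(2) rho_in[OF assms(1)] by (simp add: assoc)
qed

section \<open>\<nu> is a congruence that restricts to \<rho>\<close>

lemma nu_iff:
  "(s, t) \<in> \<nu> \<longleftrightarrow> s \<in> carrier S \<and> t \<in> carrier S \<and> (s\<^sup>\<star> \<otimes> s, t\<^sup>\<star> \<otimes> t) \<in> \<rho> \<and>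
     (\<exists>e\<in>E. (e, s\<^sup>\<star> \<otimes> s) \<in> \<rho> \<and> s \<otimes> e = t \<otimes> e)"
  by (simp add: nu_min_def)

lemma nuE:
  assumes "(s, t) \<in> \<nu>"
  obtains e where "s \<in> carrier S" "t \<in> carrier S" "e \<in> E" "(e, s\<^sup>\<star> \<otimes> s) \<in> \<rho>"
    "(s\<^sup>\<star> \<otimes> s, t\<^sup>\<star> \<otimes> t) \<in> \<rho>" "s \<otimes> e = t \<otimes> e"
  using assms unfolding nu_iff by blast

lemma nu_equiv: "equiv (carrier S) \<nu>"
proof (rule equivI)
  show "\<nu> \<subseteq> carrier S \<times> carrier S"
    by (auto simp: nu_min_def)
  show "refl_on (carrier S) \<nu>"
  proof (rule refl_onI)
    fix s assume "s \<in> carrier S"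
    then show "(s, s) \<in> \<nu>"
      unfolding nu_iff using rho_refl[of "s\<^sup>\<star> \<otimes> s"] star_mult_idems(1) by blast
  qed
  show "sym \<nu>"
  proof (rule symI, erule nuE)
    fix s t e assume *: "s \<in> carrier S" "t \<in> carrier S" "e \<in> E" "(e, s\<^sup>\<star> \<otimes> s) \<in> \<rho>"
      "(s\<^sup>\<star> \<otimes> s, t\<^sup>\<star> \<otimes> t) \<in> \<rho>" "s \<otimes> e = t \<otimes> e"
    then show "(t, s) \<in> \<nu>"
      unfolding nu_iff using rho_sym rho_trans by metis
  qed
  show "trans \<nu>"
  proof (rule transI, elim nuE)
    fix s t u e f
    assume c: "s \<in> carrier S" "t \<in> carrier S" "u \<in> carrier S" "e \<in> E" "f \<in> E"
      and e: "(e, s\<^sup>\<star> \<otimes> s) \<in> \<rho>" "(s\<^sup>\<star> \<otimes> s, t\<^sup>\<star> \<otimes> t) \<in> \<rho>" "s \<otimes> e = t \<otimes> e"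
      and f: "(f, t\<^sup>\<star> \<otimes> t) \<in> \<rho>" "(t\<^sup>\<star> \<otimes> t, u\<^sup>\<star> \<otimes> u) \<in> \<rho>" "t \<otimes> f = u \<otimes> f"
    \<comment> \<open>All of e, f and the three elements \<open>s\<^sup>\<star> s\<close>,
      \<open>t\<^sup>\<star> t\<close>, \<open>u\<^sup>\<star> u\<close> lie in one class of \<rho>,
      so \<open>e f\<close> does too and can witness the relation between s and u.\<close>
    have "(f, e) \<in> \<rho>"
      using e f by (meson rho_sym rho_trans)
    then have "(e \<otimes> f, e) \<in> \<rho>"
      using rho_mult(1)[of f e e] c by simp
    then have ef: "(e \<otimes> f, s\<^sup>\<star> \<otimes> s) \<in> \<rho>"
      using e rho_trans by blast
    have "s \<otimes> (e \<otimes> f) = s \<otimes> e \<otimes> f"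
      using c by (simp add: assoc)
    also have "\<dots> = t \<otimes> f \<otimes> e"
      unfolding e(3) using c by (simp add: assoc idem_commute[of e f])
    also have "\<dots> = u \<otimes> (e \<otimes> f)"
      unfolding f(3) using c by (simp add: assoc idem_commute[of e f])
    finally have "s \<otimes> (e \<otimes> f) = u \<otimes> (e \<otimes> f)" .
    then show "(s, u) \<in> \<nu>"
      unfolding nu_iff using c ef e(2) f(2) rho_trans idem_mult_closed by blast
  qed
qed

text \<open>With \<open>X w = (u w)\<^sup>\<star> (u w)\<close>, restricting w to e turns
  \<open>X w\<close> into \<open>e X w\<close>. As \<open>X w\<close> lies below
  \<open>w\<^sup>\<star> w\<close>, which is related to e, the product \<open>e X w\<close> is
  related to \<open>X w\<close>. From \<open>s e = t e\<close> follows \<open>e X s = e X t\<close>;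
  this links \<open>X s\<close> to \<open>X t\<close> and is also the witness for the
  products.\<close>

lemma nu_mult_left:
  assumes "(s, t) \<in> \<nu>" "u \<in> carrier S"
  shows "(u \<otimes> s, u \<otimes> t) \<in> \<nu>"
  using assms(1)
proof (rule nuE)
  fix e assume c: "s \<in> carrier S" "t \<in> carrier S" "e \<in> E" and es: "(e, s\<^sup>\<star> \<otimes> s) \<in> \<rho>"
      and st: "(s\<^sup>\<star> \<otimes> s, t\<^sup>\<star> \<otimes> t) \<in> \<rho>" and eq: "s \<otimes> e = t \<otimes> e"
  define X where "X w = (u \<otimes> w)\<^sup>\<star> \<otimes> (u \<otimes> w)" for w
  have X: "X w \<in> E" "w\<^sup>\<star> \<otimes> w \<otimes> X w = X w"
    "X (w \<otimes> e) = e \<otimes> X w" if "w \<in> carrier S" for w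
  proof -
    show 1: "X w \<in> E"
      unfolding X_def using that assms(2) star_mult_idems(1)[of "u \<otimes> w"] closed by blast
    show "w\<^sup>\<star> \<otimes> w \<otimes> X w = X w"
      unfolding X_def using that assms(2) by (simp add: assoc)
    have "X (w \<otimes> e) = e \<otimes> (X w \<otimes> e)"
      unfolding X_def using that assms(2) c by (simp add: assoc)
    then show "X (w \<otimes> e) = e \<otimes> X w"
      using 1 c by (simp add: idem_commute[of "X w" e])
  qed
  have absorb: "(e \<otimes> X w, X w) \<in> \<rho>" if "w \<in> carrier S" "(e, w\<^sup>\<star> \<otimes> w) \<in> \<rho>" for w
    using rho_mult(2)[OF that(2) X(1)[OF that(1)]] X(2)[OF that(1)] by simp
  have "X (s \<otimes> e) = X (t \<otimes> e)"
    using eq by simp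
  then have eX: "e \<otimes> X s = e \<otimes> X t"
    using X(3) c by simp
  have "(e \<otimes> X s, X s) \<in> \<rho>" "(e \<otimes> X t, X t) \<in> \<rho>"
    using absorb c es st rho_trans by blast+
  moreover from this have "(X s, X t) \<in> \<rho>"
    using eX rho_sym rho_trans by metis
  moreover have "u \<otimes> s \<otimes> (e \<otimes> X s) = u \<otimes> (s \<otimes> e) \<otimes> X s"
    using c assms(2) X(1) by (simp add: assoc)
  then have "u \<otimes> s \<otimes> (e \<otimes> X s) = u \<otimes> t \<otimes> (e \<otimes> X s)"
    unfolding eq using c assms(2) X(1) by (simp add: assoc)
  moreover have "e \<otimes> X s \<in> E"
    using c X(1) by simp
  ultimately show "(u \<otimes> s, u \<otimes> t) \<in> \<nu>"
    unfolding nu_iff X_def using c assms(2) closed by blast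
qed

text \<open>Here invariance of \<rho> under conjugation enters:
  \<open>(w u)\<^sup>\<star> (w u)\<close> is \<open>w\<^sup>\<star> w\<close> conjugated by u. The
  witness is e conjugated in the same way, since
  \<open>w u (u\<^sup>\<star> e u) = w e u\<close>.\<close>

lemma nu_mult_right:
  assumes "(s, t) \<in> \<nu>" "u \<in> carrier S"
  shows "(s \<otimes> u, t \<otimes> u) \<in> \<nu>"
  using assms(1)
proof (rule nuE)
  fix e assume c: "s \<in> carrier S" "t \<in> carrier S" "e \<in> E" and es: "(e, s\<^sup>\<star> \<otimes> s) \<in> \<rho>"
      and st: "(s\<^sup>\<star> \<otimes> s, t\<^sup>\<star> \<otimes> t) \<in> \<rho>" and eq: "s \<otimes> e = t \<otimes> e"
  let ?g = "u\<^sup>\<star> \<otimes> (e \<otimes> u)"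
  have *: "(w \<otimes> u)\<^sup>\<star> \<otimes> (w \<otimes> u) = u\<^sup>\<star> \<otimes> ((w\<^sup>\<star> \<otimes> w) \<otimes> u)" "w \<otimes> u \<otimes> ?g = w \<otimes> e \<otimes> u"
    if "w \<in> carrier S" for w
    using that c assms(2) by (simp_all add: assoc star_mult_left_commute)
  have "?g \<in> E" "s \<otimes> u \<in> carrier S" "t \<otimes> u \<in> carrier S"
    using c assms(2) by simp_all
  moreover have "s \<otimes> u \<otimes> ?g = t \<otimes> u \<otimes> ?g"
    using * c eq by simp
  ultimately show "(s \<otimes> u, t \<otimes> u) \<in> \<nu>"
    unfolding nu_iff *(1)[OF c(1)] *(1)[OF c(2)]
    using rho_conj[OF es assms(2)] rho_conj[OF st assms(2)] by blast
qed

lemma nu_congruence: "sgrp_congruence S \<nu>"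
  unfolding sgrp_congruence_def using nu_equiv nu_mult_left nu_mult_right by blast

text \<open>For idempotents \<open>e\<^sup>\<star> e = e\<close>, so the first clause of
  \<open>nu_min\<close> is already \<rho>; conversely \<open>e f\<close> is related to e and
  witnesses the second. This makes the map from E(S)/\<rho> to the idempotents of the quotient
  injective.\<close>

lemma nu_idem_iff:
  assumes "e \<in> E" "f \<in> E"
  shows "(e, f) \<in> \<nu> \<longleftrightarrow> (e, f) \<in> \<rho>"
proof
  assume "(e, f) \<in> \<nu>"
  then show "(e, f) \<in> \<rho>"
    by (rule nuE) (use assms in simp)
next
  assume ef: "(e, f) \<in> \<rho>"
  have "(e \<otimes> f, e) \<in> \<rho>"
    using rho_mult(1)[OF rho_sym[OF ef] assms(1)] assms by simp
  then show "(e, f) \<in> \<nu>"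
    unfolding nu_iff using assms ef
    by (auto intro!: bexI[of _ "e \<otimes> f"] simp: idem_left_commute[of f e f])
qed

section \<open>The quotient as an inverse semigroup\<close>

lemma cls_eq_iff: "\<lbrakk>s \<in> carrier S; t \<in> carrier S\<rbrakk> \<Longrightarrow> cls s = cls t \<longleftrightarrow> (s, t) \<in> \<nu>"
  using eq_equiv_class_iff[OF nu_equiv] .

lemma cls_self: "s \<in> carrier S \<Longrightarrow> s \<in> cls s"
  by (rule equiv_class_self[OF nu_equiv])

lemma cls_mult: "\<lbrakk>s \<in> carrier S; t \<in> carrier S\<rbrakk> \<Longrightarrow> cls s \<otimes>\<^bsub>Q\<^esub> cls t = cls (s \<otimes> t)"
  by (rule quot_sgrp_mult[OF nu_congruence])

lemma carrier_Q: "carrier Q = cls ` carrier S"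
  by (auto simp: quot_sgrp_def quotient_def)

lemma cls_closed: "s \<in> carrier S \<Longrightarrow> cls s \<in> carrier Q"
  by (simp add: carrier_Q)

lemma QE:
  assumes "A \<in> carrier Q"
  obtains s where "s \<in> carrier S" "A = cls s"
  using assms unfolding carrier_Q by blast

text \<open>Lallement's lemma: the idempotent \<open>s (s s)\<^sup>\<star> s\<close> lies in the class of \<open>s\<close>.\<close>

lemma idem_Q: "carrier (idem Q) = cls ` E"
proof (intro equalityI subsetI)
  fix A assume "A \<in> carrier (idem Q)"
  then have A: "A \<in> carrier Q" "A \<otimes>\<^bsub>Q\<^esub> A = A"
    by (simp_all add: idem_iff)
  obtain s where s: "s \<in> carrier S" "A = cls s"
    using A(1) by (rule QE)
  have ss: "cls (s \<otimes> s) = cls s"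
    using A(2) s cls_mult by simp
  let ?x = "(s \<otimes> s)\<^sup>\<star>"
  have x: "?x \<in> carrier S"
    using s(1) star_closed closed by blast
  let ?e = "s \<otimes> ?x \<otimes> s"
  have "?e \<otimes> ?e = s \<otimes> (?x \<otimes> (s \<otimes> s) \<otimes> ?x) \<otimes> s"
    using s(1) x by (simp only: assoc closed)
  also have "\<dots> = ?e"
    using star_props(3)[of "s \<otimes> s"] s(1) closed by simp
  finally have e: "?e \<in> E"
    unfolding idem_iff using s(1) x closed by blast
  have "cls ?e = cls s \<otimes>\<^bsub>Q\<^esub> cls ?x \<otimes>\<^bsub>Q\<^esub> cls s"
    using s(1) x by (simp only: cls_mult closed)
  \<comment> \<open>Idempotency of the class of s allows s to be replaced by \<open>s s\<close> on
    both sides, after which \<open>?x\<close> cancels as the inverse of \<open>s s\<close>.\<close>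
  also have "\<dots> = cls (s \<otimes> s) \<otimes>\<^bsub>Q\<^esub> cls ?x \<otimes>\<^bsub>Q\<^esub> cls (s \<otimes> s)"
    by (simp only: ss)
  also have "\<dots> = cls (s \<otimes> s \<otimes> ?x \<otimes> (s \<otimes> s))"
    using s(1) x by (simp only: cls_mult closed)
  also have "\<dots> = cls s"
    using star_props(2)[of "s \<otimes> s"] s(1) closed ss by simp
  finally show "A \<in> cls ` E"
    using e s(2) by blast
next
  fix A assume "A \<in> cls ` E"
  then obtain e where "e \<in> E" "A = cls e"
    by blast
  then show "A \<in> carrier (idem Q)"
    unfolding idem_iff[of A] by (simp add: cls_closed cls_mult)
qed

text \<open>Existence of inverses passes to classes. For uniqueness, idempotents of the quotient
  lift to idempotents of S by \<open>idem_Q\<close> and hence commute; then two inverses T and U of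
  A are both equal to \<open>U A T\<close>.\<close>

sublocale Q: inverse_semigroup Q
proof
  fix A B C assume "A \<in> carrier Q" "B \<in> carrier Q" "C \<in> carrier Q"
  then show "A \<otimes>\<^bsub>Q\<^esub> B \<otimes>\<^bsub>Q\<^esub> C = A \<otimes>\<^bsub>Q\<^esub> (B \<otimes>\<^bsub>Q\<^esub> C)"
    by (elim QE) (simp add: cls_mult assoc)
next
  show Q_closed: "A \<otimes>\<^bsub>Q\<^esub> B \<in> carrier Q" if "A \<in> carrier Q" "B \<in> carrier Q" for A B
    using that by (elim QE) (simp add: cls_mult cls_closed)
  have Q_assoc: "A \<otimes>\<^bsub>Q\<^esub> B \<otimes>\<^bsub>Q\<^esub> C = A \<otimes>\<^bsub>Q\<^esub> (B \<otimes>\<^bsub>Q\<^esub> C)"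
    if "A \<in> carrier Q" "B \<in> carrier Q" "C \<in> carrier Q" for A B C
    using that by (elim QE) (simp add: cls_mult assoc)
  have comm: "A \<otimes>\<^bsub>Q\<^esub> B = B \<otimes>\<^bsub>Q\<^esub> A"
    if "A \<in> carrier (idem Q)" "B \<in> carrier (idem Q)" for A B
    using that unfolding idem_Q by (auto simp: cls_mult idem_commute)
  fix A assume A: "A \<in> carrier Q"
  then obtain s where s: "s \<in> carrier S" "A = cls s"
    by (rule QE)
  let ?inv = "\<lambda>T. T \<in> carrier Q \<and> A = A \<otimes>\<^bsub>Q\<^esub> T \<otimes>\<^bsub>Q\<^esub> A \<and> T = T \<otimes>\<^bsub>Q\<^esub> A \<otimes>\<^bsub>Q\<^esub> T"
  have "?inv (cls (s\<^sup>\<star>))"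
    using s star_props[OF s(1)] by (simp add: cls_mult cls_closed)
  moreover have "T = U" if T: "?inv T" and U: "?inv U" for T U
  proof -
    have idem: "A \<otimes>\<^bsub>Q\<^esub> V \<in> carrier (idem Q)" "V \<otimes>\<^bsub>Q\<^esub> A \<in> carrier (idem Q)" if "?inv V" for V
      unfolding idem_iff using that A Q_closed Q_assoc by metis+
    have t: "T \<in> carrier Q" and u: "U \<in> carrier Q"
      using T U by auto
    have "T = T \<otimes>\<^bsub>Q\<^esub> (A \<otimes>\<^bsub>Q\<^esub> U \<otimes>\<^bsub>Q\<^esub> A) \<otimes>\<^bsub>Q\<^esub> T"
      using T U by metis
    also have "\<dots> = (T \<otimes>\<^bsub>Q\<^esub> A) \<otimes>\<^bsub>Q\<^esub> (U \<otimes>\<^bsub>Q\<^esub> A) \<otimes>\<^bsub>Q\<^esub> T"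
      using A t u by (simp only: Q_assoc Q_closed)
    also have "\<dots> = (U \<otimes>\<^bsub>Q\<^esub> A) \<otimes>\<^bsub>Q\<^esub> (T \<otimes>\<^bsub>Q\<^esub> A) \<otimes>\<^bsub>Q\<^esub> T"
      using comm[OF idem(2)[OF T] idem(2)[OF U]] by (simp only:)
    also have "\<dots> = U \<otimes>\<^bsub>Q\<^esub> A \<otimes>\<^bsub>Q\<^esub> (T \<otimes>\<^bsub>Q\<^esub> A \<otimes>\<^bsub>Q\<^esub> T)"
      using A t u by (simp only: Q_assoc Q_closed)
    also have "\<dots> = U \<otimes>\<^bsub>Q\<^esub> A \<otimes>\<^bsub>Q\<^esub> T"
      using T by metis
    finally have 1: "T = U \<otimes>\<^bsub>Q\<^esub> A \<otimes>\<^bsub>Q\<^esub> T" .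
    have "U = U \<otimes>\<^bsub>Q\<^esub> (A \<otimes>\<^bsub>Q\<^esub> T \<otimes>\<^bsub>Q\<^esub> A) \<otimes>\<^bsub>Q\<^esub> U"
      using T U by metis
    also have "\<dots> = U \<otimes>\<^bsub>Q\<^esub> ((A \<otimes>\<^bsub>Q\<^esub> T) \<otimes>\<^bsub>Q\<^esub> (A \<otimes>\<^bsub>Q\<^esub> U))"
      using A t u by (simp only: Q_assoc Q_closed)
    also have "\<dots> = U \<otimes>\<^bsub>Q\<^esub> ((A \<otimes>\<^bsub>Q\<^esub> U) \<otimes>\<^bsub>Q\<^esub> (A \<otimes>\<^bsub>Q\<^esub> T))"
      using comm[OF idem(1)[OF T] idem(1)[OF U]] by (simp only:)
    also have "\<dots> = (U \<otimes>\<^bsub>Q\<^esub> A \<otimes>\<^bsub>Q\<^esub> U) \<otimes>\<^bsub>Q\<^esub> A \<otimes>\<^bsub>Q\<^esub> T"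
      using A t u by (simp only: Q_assoc Q_closed)
    also have "\<dots> = U \<otimes>\<^bsub>Q\<^esub> A \<otimes>\<^bsub>Q\<^esub> T"
      using U by metis
    finally show ?thesis
      using 1 by simp
  qed
  ultimately show "\<exists>!T. ?inv T"
    by (intro ex1I) blast+
qed

lemma star_cls: "s \<in> carrier S \<Longrightarrow> star Q (cls s) = cls (s\<^sup>\<star>)"
  using star_props[of s] by (intro Q.star_eqI) (simp_all add: cls_mult cls_closed)

section \<open>The isomorphism\<close>

definition pull :: "('a set \<Rightarrow> nat) \<Rightarrow> 'a \<Rightarrow> nat" where
  "pull \<xi> = (\<lambda>e\<in>E. \<xi> (cls e))"

lemma pull_apply [simp]: "e \<in> E \<Longrightarrow> pull \<xi> e = \<xi> (cls e)"
  by (simp add: pull_def)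

lemma cls_idem: "e \<in> E \<Longrightarrow> cls e \<in> carrier (idem Q)"
  by (simp add: idem_Q)

lemma pull_character:
  assumes "\<xi> \<in> characters (idem Q)"
  shows "pull \<xi> \<in> characters (idem S)"
proof -
  have "pull \<xi> \<in> E \<rightarrow>\<^sub>E {0, 1}"
    using Q.charD(2)[OF assms] by (auto simp: pull_def cls_idem)
  moreover have "pull \<xi> (e \<otimes> f) = pull \<xi> e * pull \<xi> f" if "e \<in> E" "f \<in> E" for e f
    using that Q.charD(1)[OF assms, of "cls e" "cls f"] by (simp add: cls_idem cls_mult)
  moreover obtain e where "e \<in> E" "\<xi> (cls e) = 1"
    using Q.charD(3)[OF assms] unfolding idem_Q by blast
  then have "\<exists>e\<in>E. pull \<xi> e \<noteq> 0"
    by (intro bexI[of _ e]) simp_all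
  ultimately show ?thesis
    by (simp add: characters_def)
qed

lemma pull_inj:
  assumes "\<xi> \<in> characters (idem Q)" "\<eta> \<in> characters (idem Q)" "pull \<xi> = pull \<eta>"
  shows "\<xi> = \<eta>"
proof (rule PiE_ext)
  show "\<xi> \<in> carrier (idem Q) \<rightarrow>\<^sub>E {0, 1}" "\<eta> \<in> carrier (idem Q) \<rightarrow>\<^sub>E {0, 1}"
    using assms by (auto simp: characters_def)
  show "\<xi> A = \<eta> A" if A: "A \<in> carrier (idem Q)" for A
  proof -
    obtain e where "e \<in> E" "A = cls e"
      using A unfolding idem_Q by blast
    then show ?thesis
      using fun_cong[OF assms(3), of e] by simp
  qed
qed

lemma F_set_eq: "F_set S \<rho> = pull ` characters (idem Q)"
proof (intro equalityI subsetI)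
  let ?R = "quot_sgrp (idem S) \<rho>"
  have R: "carrier ?R = (\<lambda>e. \<rho> `` {e}) ` E"
    by (auto simp: quot_sgrp_def quotient_def)
  have R_mult: "\<rho> `` {e} \<otimes>\<^bsub>?R\<^esub> \<rho> `` {f} = \<rho> `` {e \<otimes> f}" if "e \<in> E" "f \<in> E" for e f
    using quot_sgrp_mult[OF rho_congruence that] by simp
  fix \<psi>
  {
    assume "\<psi> \<in> F_set S \<rho>"
    then obtain \<eta> where \<eta>: "\<eta> \<in> characters ?R" and \<psi>: "\<psi> = (\<lambda>e\<in>E. \<eta> (\<rho> `` {e}))"
      unfolding F_set_def by blast
    have \<eta>_val: "\<eta> (\<rho> `` {e}) \<in> {0, 1}" if "e \<in> E" for e
      using \<eta> R that unfolding characters_def by blast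
    have \<eta>_mult: "\<eta> (\<rho> `` {e \<otimes> f}) = \<eta> (\<rho> `` {e}) * \<eta> (\<rho> `` {f})" if "e \<in> E" "f \<in> E" for e f
    proof -
      have "\<eta> (\<rho> `` {e} \<otimes>\<^bsub>?R\<^esub> \<rho> `` {f}) = \<eta> (\<rho> `` {e}) * \<eta> (\<rho> `` {f})"
        using \<eta> R that unfolding characters_def by blast
      then show ?thesis
        unfolding R_mult[OF that] .
    qed
    have \<eta>_nonzero: "\<exists>e\<in>E. \<eta> (\<rho> `` {e}) \<noteq> 0"
      using \<eta> R unfolding characters_def by auto
    \<comment> \<open>Cutting a class of \<nu> down to its idempotents gives back the class of
      \<rho> on which \<eta> is defined.\<close>
    define \<xi> where "\<xi> = (\<lambda>A\<in>carrier (idem Q). \<eta> (A \<inter> E))"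
    have "cls e \<inter> E = \<rho> `` {e}" if "e \<in> E" for e
      using nu_idem_iff[OF that] rho_in by auto
    then have \<xi>: "\<xi> (cls e) = \<eta> (\<rho> `` {e})" if "e \<in> E" for e
      using that by (simp add: \<xi>_def cls_idem)
    have "\<xi> \<in> carrier (idem Q) \<rightarrow>\<^sub>E {0, 1}"
    proof (rule PiE_I)
      show "\<xi> A \<in> {0, 1}" if "A \<in> carrier (idem Q)" for A
      proof -
        obtain e where e: "e \<in> E" "A = cls e"
          using \<open>A \<in> carrier (idem Q)\<close> unfolding idem_Q by blast
        show ?thesis
          unfolding e(2) \<xi>[OF e(1)] by (rule \<eta>_val[OF e(1)])
      qed
    qed (simp add: \<xi>_def)
    moreover have "\<xi> (A \<otimes>\<^bsub>Q\<^esub> B) = \<xi> A * \<xi> B" if "A \<in> carrier (idem Q)" "B \<in> carrier (idem Q)" for A B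
      using that \<eta>_mult unfolding idem_Q by (auto simp: cls_mult \<xi>)
    moreover have "\<exists>A\<in>carrier (idem Q). \<xi> A \<noteq> 0"
      using \<eta>_nonzero unfolding idem_Q by (auto simp: \<xi>)
    ultimately have "\<xi> \<in> characters (idem Q)"
      unfolding characters_def by simp
    moreover have "\<psi> = pull \<xi>"
      unfolding \<psi> pull_def using \<xi> by (intro restrict_ext) simp
    ultimately show "\<psi> \<in> pull ` characters (idem Q)"
      by blast
  next
    assume "\<psi> \<in> pull ` characters (idem Q)"
    then obtain \<xi> where \<xi>: "\<xi> \<in> characters (idem Q)" and \<psi>: "\<psi> = pull \<xi>"
      by blast
    \<comment> \<open>In the other direction, the members of a class of \<rho> all have the same
      class under \<nu>, so the union is that class and no representative has to be chosen.\<close>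
    define \<eta> where "\<eta> = (\<lambda>B\<in>carrier ?R. \<xi> (\<Union>e\<in>B. cls e))"
    have "(\<Union>f\<in>\<rho> `` {e}. cls f) = cls e" if "e \<in> E" for e
    proof (rule UN_const_eq)
      show "e \<in> \<rho> `` {e}"
        using rho_refl[OF that] by simp
      show "cls f = cls e" if "f \<in> \<rho> `` {e}" for f
      proof -
        have "(f, e) \<in> \<rho>"
          using that rho_sym by blast
        then show ?thesis
          using rho_in by (simp add: cls_eq_iff nu_idem_iff)
      qed
    qed
    then have \<eta>: "\<eta> (\<rho> `` {e}) = pull \<xi> e" if "e \<in> E" for e
      using that by (simp add: \<eta>_def R)
    note pull = charD[OF pull_character[OF \<xi>]]
    have "\<eta> \<in> carrier ?R \<rightarrow>\<^sub>E {0, 1}"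
    proof (rule PiE_I)
      show "\<eta> B \<in> {0, 1}" if "B \<in> carrier ?R" for B
      proof -
        obtain e where e: "e \<in> E" "B = \<rho> `` {e}"
          using \<open>B \<in> carrier ?R\<close> unfolding R by blast
        show ?thesis
          unfolding e(2) \<eta>[OF e(1)] using pull(2)[OF e(1)] by blast
      qed
    qed (simp add: \<eta>_def)
    moreover have "\<eta> (A \<otimes>\<^bsub>?R\<^esub> B) = \<eta> A * \<eta> B" if AB: "A \<in> carrier ?R" "B \<in> carrier ?R" for A B
    proof -
      obtain e f where ef: "e \<in> E" "f \<in> E" "A = \<rho> `` {e}" "B = \<rho> `` {f}"
        using AB unfolding R by blast
      show ?thesis
        unfolding ef(3,4) R_mult[OF ef(1,2)] \<eta>[OF ef(1)] \<eta>[OF ef(2)]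
          \<eta>[OF idem_mult_closed[OF ef(1,2)]] by (rule pull(1)[OF ef(1,2)])
    qed
    moreover have "\<exists>A\<in>carrier ?R. \<eta> A \<noteq> 0"
    proof -
      obtain e where e: "e \<in> E" "pull \<xi> e = 1"
        using pull(3) by blast
      then have "\<eta> (\<rho> `` {e}) \<noteq> 0"
        using \<eta>[OF e(1)] by simp
      then show ?thesis
        unfolding R using e(1) by blast
    qed
    ultimately have "\<eta> \<in> characters ?R"
      unfolding characters_def by simp
    moreover have "\<psi> = (\<lambda>e\<in>E. \<eta> (\<rho> `` {e}))"
      unfolding \<psi> pull_def using \<eta> by (intro restrict_ext) simp
    ultimately show "\<psi> \<in> F_set S \<rho>"
      unfolding F_set_def by blast
  }
qed

text \<open>The coordinate of \<open>pull \<xi>\<close> at e is the coordinate of \<xi> at the class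
  of e, so every coordinate is a projection.\<close>

lemma pull_continuous:
  "continuous_map (character_space (idem Q)) (character_space (idem S)) pull"
proof -
  have "continuous_map (character_space (idem Q)) (discrete_topology {0, 1}) (\<lambda>\<xi>. pull \<xi> e)"
    if "e \<in> E" for e
    unfolding character_space_def pull_apply[OF that]
    by (intro continuous_map_from_subtopology continuous_map_product_projection cls_idem that)
  then have "continuous_map (character_space (idem Q))
      (product_topology (\<lambda>_. discrete_topology {0, 1}) E) pull"
    unfolding continuous_map_componentwise by (auto simp: pull_def)
  then show ?thesis
    unfolding character_space_def[of "idem S"] continuous_map_in_subtopology
    using pull_character by (auto simp: Q.topspace_character_space)
qed

text \<open>This makes \<open>pull\<close> an embedding: open sets upstairs are traces on
  \<open>F_set S \<rho>\<close> of open sets of characters of E(S).\<close>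

lemma pull_open:
  assumes "openin (character_space (idem Q)) V"
  obtains U where "openin (character_space (idem S)) U" "pull ` V = U \<inter> F_set S \<rho>"
proof -
  let ?P = "product_topology (\<lambda>_. discrete_topology {0, 1 :: nat}) (carrier (idem Q))"
  obtain W where W: "openin ?P W" "V = W \<inter> characters (idem Q)"
    using assms unfolding character_space_def openin_subtopology by blast
  \<comment> \<open>A left inverse of \<open>pull\<close> on characters, built by choosing an
    idempotent in each class. It is defined on all characters of E(S), also those not constant on
    classes, so its values need not be characters. Continuity into the full product is enough and
    holds because each coordinate is evaluation at a fixed idempotent.\<close>
  define push where "push \<psi> = (\<lambda>A\<in>carrier (idem Q). \<psi> (SOME e. e \<in> E \<and> A = cls e))" for \<psi> :: "'a \<Rightarrow> nat"
  have rep: "(SOME e. e \<in> E \<and> A = cls e) \<in> E" "A = cls (SOME e. e \<in> E \<and> A = cls e)"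
    if "A \<in> carrier (idem Q)" for A
    using someI_ex[of "\<lambda>e. e \<in> E \<and> A = cls e"] that unfolding idem_Q by blast+
  have push_pull: "push (pull \<xi>) = \<xi>" if "\<xi> \<in> characters (idem Q)" for \<xi>
  proof (rule PiE_ext)
    show "push (pull \<xi>) \<in> carrier (idem Q) \<rightarrow>\<^sub>E UNIV"
      by (simp add: push_def)
    show "\<xi> \<in> carrier (idem Q) \<rightarrow>\<^sub>E UNIV"
      using that by (auto simp: characters_def)
    show "push (pull \<xi>) A = \<xi> A" if "A \<in> carrier (idem Q)" for A
      using rep[OF that] that by (simp add: push_def)
  qed
  have "continuous_map (character_space (idem S)) (discrete_topology {0, 1}) (\<lambda>\<psi>. push \<psi> A)"
    if "A \<in> carrier (idem Q)" for A
    unfolding character_space_def push_def restrict_apply'[OF that]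
    by (intro continuous_map_from_subtopology continuous_map_product_projection rep that)
  then have "continuous_map (character_space (idem S)) ?P push"
    unfolding continuous_map_componentwise by (auto simp: push_def)
  from openin_continuous_map_preimage[OF this W(1)]
  have "openin (character_space (idem S)) {\<psi> \<in> characters (idem S). push \<psi> \<in> W}"
    by (simp add: topspace_character_space)
  moreover have "pull ` V = {\<psi> \<in> characters (idem S). push \<psi> \<in> W} \<inter> F_set S \<rho>"
    unfolding F_set_eq W(2) using push_pull pull_character by auto
  ultimately show ?thesis
    by (rule that)
qed

section \<open>Pulling germs back: the map on arrows\<close>

lemma germ_pairs_pull:
  assumes "s \<in> carrier S"
  shows "(cls s, \<xi>) \<in> germ_pairs Q \<longleftrightarrow> \<xi> \<in> characters (idem Q) \<and> (s, pull \<xi>) \<in> germ_pairs S"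
  using assms by (auto simp: germ_pairs_iff Q.germ_pairs_iff star_cls cls_mult cls_closed pull_character)

lemma germ_pull_eq_iff:
  assumes s: "s \<in> carrier S" "(cls s, \<xi>) \<in> germ_pairs Q"
    and t: "t \<in> carrier S" "(cls t, \<eta>) \<in> germ_pairs Q"
  shows "germ Q (cls s) \<xi> = germ Q (cls t) \<eta> \<longleftrightarrow> germ S s (pull \<xi>) = germ S t (pull \<eta>)"
proof -
  have ps: "\<xi> \<in> characters (idem Q)" "(s, pull \<xi>) \<in> germ_pairs S"
    and pt: "\<eta> \<in> characters (idem Q)" "(t, pull \<eta>) \<in> germ_pairs S"
    using s t germ_pairs_pull by auto
  have "(\<exists>A\<in>carrier (idem Q). \<xi> A = 1 \<and> cls s \<otimes>\<^bsub>Q\<^esub> A = cls t \<otimes>\<^bsub>Q\<^esub> A) \<longleftrightarrow>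
    (\<exists>e\<in>E. pull \<xi> e = 1 \<and> s \<otimes> e = t \<otimes> e)" (is "?L \<longleftrightarrow> ?R")
  proof
    assume ?L
    then obtain e where e: "e \<in> E" "\<xi> (cls e) = 1" "cls s \<otimes>\<^bsub>Q\<^esub> cls e = cls t \<otimes>\<^bsub>Q\<^esub> cls e"
      unfolding idem_Q by blast
    then have "(s \<otimes> e, t \<otimes> e) \<in> \<nu>"
      using s(1) t(1) by (simp add: cls_mult cls_eq_iff)
    then obtain f where f: "f \<in> E" "(f, (s \<otimes> e)\<^sup>\<star> \<otimes> (s \<otimes> e)) \<in> \<rho>" "s \<otimes> e \<otimes> f = t \<otimes> e \<otimes> f"
      by (rule nuE)
    have X: "(s \<otimes> e)\<^sup>\<star> \<otimes> (s \<otimes> e) = e \<otimes> (s\<^sup>\<star> \<otimes> s)"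
      using s(1) e(1) by (simp add: assoc star_mult_commute)
    have "cls f = cls (e \<otimes> (s\<^sup>\<star> \<otimes> s))"
      using f(1,2) s(1) e(1) unfolding X by (simp add: cls_eq_iff nu_idem_iff)
    then have "pull \<xi> f = pull \<xi> (e \<otimes> (s\<^sup>\<star> \<otimes> s))"
      using f(1) s(1) e(1) by simp
    also have "\<dots> = pull \<xi> e * pull \<xi> (s\<^sup>\<star> \<otimes> s)"
      by (rule charD(1)[OF pull_character[OF ps(1)] e(1) star_mult_idems(1)[OF s(1)]])
    also have "\<dots> = 1"
      using e(1,2) ps(2) by (simp add: germ_pairs_iff del: pull_apply) (simp add: e)
    finally have "pull \<xi> (e \<otimes> f) = 1"
      using charD(1)[OF pull_character[OF ps(1)] e(1) f(1)] e(1,2) by simp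
    moreover have "s \<otimes> (e \<otimes> f) = t \<otimes> (e \<otimes> f)"
      using f(3) s(1) t(1) e(1) f(1) by (simp add: assoc)
    ultimately show ?R
      using e(1) f(1) idem_mult_closed by blast
  next
    assume ?R
    then obtain e where "e \<in> E" "pull \<xi> e = 1" "s \<otimes> e = t \<otimes> e"
      by blast
    then show ?L
      using s(1) t(1) by (intro bexI[of _ "cls e"]) (simp_all add: cls_mult cls_idem)
  qed
  moreover have "\<xi> = \<eta> \<longleftrightarrow> pull \<xi> = pull \<eta>"
    using pull_inj[OF ps(1) pt(1)] by blast
  ultimately show ?thesis
    unfolding germ_eq_iff[OF ps(2) pt(2)] Q.germ_eq_iff[OF s(2) t(2)] by blast
qed

text \<open>Equivariance of \<open>pull\<close>: both sides evaluate \<xi> at the class of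
  \<open>s\<^sup>\<star> e s\<close>. It carries the compatibility with ranges, inverses and
  products.\<close>

lemma pull_beta:
  assumes "s \<in> carrier S"
  shows "pull (beta Q (cls s) \<xi>) = beta S s (pull \<xi>)"
  unfolding pull_def[of "beta Q (cls s) \<xi>"] beta_def[of S]
proof (rule restrict_ext)
  fix e assume "e \<in> E"
  then show "beta Q (cls s) \<xi> (cls e) = pull \<xi> (s\<^sup>\<star> \<otimes> e \<otimes> s)"
    using assms by (simp add: Q.beta_apply cls_idem cls_closed star_cls cls_mult assoc)
qed

text \<open>The union runs over all representatives of the germ and all members of the class, so
  that nothing is chosen. By \<open>germ_pull_eq_iff\<close> its terms coincide, and the value on an
  arrow is a single germ.\<close>

definition arrow_map :: "('a set \<times> ('a set \<Rightarrow> nat)) set \<Rightarrow> ('a \<times> ('a \<Rightarrow> nat)) set" where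
  "arrow_map a = (\<Union>(A, \<xi>)\<in>a. \<Union>s\<in>A. germ S s (pull \<xi>))"

lemma arrow_map_germ:
  assumes "s \<in> carrier S" "(cls s, \<xi>) \<in> germ_pairs Q"
  shows "arrow_map (germ Q (cls s) \<xi>) = germ S s (pull \<xi>)"
proof -
  have *: "germ S t (pull \<eta>) = germ S s (pull \<xi>)"
    if "(A, \<eta>) \<in> germ Q (cls s) \<xi>" "t \<in> A" for A \<eta> t
  proof -
    have A: "(A, \<eta>) \<in> germ_pairs Q" "germ Q (cls s) \<xi> = germ Q A \<eta>"
      using that(1) Q.germ_eq_iff[OF assms(2)] unfolding Q.in_germ_iff[OF assms(2)] by blast+
    have t: "t \<in> carrier S" "A = cls t"
    proof -
      have "A \<in> carrier Q"
        using A(1) by (simp add: Q.germ_pairs_iff)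
      then obtain u where "u \<in> carrier S" "A = cls u"
        by (rule QE)
      moreover from this have "(u, t) \<in> \<nu>"
        using that(2) by simp
      ultimately show "t \<in> carrier S" "A = cls t"
        using equiv_class_eq[OF nu_equiv] nu_iff by auto
    qed
    show ?thesis
      using germ_pull_eq_iff[OF assms t(1)] A t(2) by blast
  qed
  have "s \<in> cls s" "(cls s, \<xi>) \<in> germ Q (cls s) \<xi>"
    using cls_self assms Q.self_in_germ by blast+
  then show ?thesis
    unfolding arrow_map_def using * by blast
qed

lemma arrow_map_unit_germ:
  assumes "\<xi> \<in> characters (idem Q)"
  shows "arrow_map (unit_germ Q \<xi>) = unit_germ S (pull \<xi>)"
proof -
  obtain e where e: "e \<in> E" "\<xi> (cls e) = 1"
    using Q.charD(3)[OF assms] unfolding idem_Q by blast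
  have "(cls e, \<xi>) \<in> germ_pairs Q"
    using e assms by (simp add: germ_pairs_pull germ_pairs_iff pull_character)
  then show ?thesis
    using e assms
    by (simp add: Q.unit_germ_eq[OF assms cls_idem[OF e(1)] e(2)] arrow_map_germ
        unit_germ_eq[OF pull_character[OF assms] e(1)])
qed

lemma Q_arrowE:
  assumes "a \<in> arrows (universal_groupoid Q)"
  obtains s \<xi> where "s \<in> carrier S" "\<xi> \<in> characters (idem Q)" "(cls s, \<xi>) \<in> germ_pairs Q"
    "(s, pull \<xi>) \<in> germ_pairs S" "a = germ Q (cls s) \<xi>"
proof -
  obtain A \<xi> where A: "(A, \<xi>) \<in> germ_pairs Q" "a = germ Q A \<xi>"
    using assms by (rule Q.arrowE)
  then have "A \<in> carrier Q"
    by (simp add: Q.germ_pairs_iff)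
  then obtain s where "s \<in> carrier S" "A = cls s"
    by (rule QE)
  then show ?thesis
    using that A germ_pairs_pull by blast
qed

abbreviation "GQ \<equiv> universal_groupoid Q"
abbreviation "GF \<equiv> reduction (universal_groupoid S) (unit_germ S ` F_set S \<rho>)"

text \<open>The reduction tests the unit arrow at the source of a germ, not its character. As
  \<open>unit_germ\<close> is injective on characters, the test says that the character is a
  pullback. The right-hand side is visibly the image of \<open>arrow_map\<close>.\<close>

lemma arrows_GF: "arrows GF = {germ S s (pull \<xi>) | s \<xi>. s \<in> carrier S \<and> (cls s, \<xi>) \<in> germ_pairs Q}"
proof (intro equalityI subsetI)
  fix a assume "a \<in> arrows GF"
  then have a: "a \<in> arrows (universal_groupoid S)"
    "gdom (universal_groupoid S) a \<in> unit_germ S ` F_set S \<rho>"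
    by (auto simp: reduction_def)
  obtain s \<psi> where s: "(s, \<psi>) \<in> germ_pairs S" "a = germ S s \<psi>"
    using a(1) by (rule arrowE)
  then obtain \<xi> where \<xi>: "\<xi> \<in> characters (idem Q)" "unit_germ S \<psi> = unit_germ S (pull \<xi>)"
    using a(2) gdom_germ[OF s(1)] unfolding F_set_eq by auto
  have "\<psi> = pull \<xi>"
    using s(1) \<xi> pull_character by (intro unit_germ_inj) (auto simp: germ_pairs_iff)
  then show "a \<in> {germ S s (pull \<xi>) | s \<xi>. s \<in> carrier S \<and> (cls s, \<xi>) \<in> germ_pairs Q}"
    using s \<xi> germ_pairs_pull germ_pairs_iff by blast
next
  fix a assume "a \<in> {germ S s (pull \<xi>) | s \<xi>. s \<in> carrier S \<and> (cls s, \<xi>) \<in> germ_pairs Q}"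
  then obtain s \<xi> where "a = germ S s (pull \<xi>)" "\<xi> \<in> characters (idem Q)" "(s, pull \<xi>) \<in> germ_pairs S"
    using germ_pairs_pull by blast
  then show "a \<in> arrows GF"
    using germ_in_arrows[of s "pull \<xi>"] gdom_germ[of s "pull \<xi>"]
    by (auto simp: reduction_def F_set_eq)
qed

lemma arrow_map_image: "arrow_map ` arrows GQ = arrows GF"
  unfolding arrows_GF
proof (intro equalityI subsetI)
  fix b assume "b \<in> arrow_map ` arrows GQ"
  then obtain a where "a \<in> arrows GQ" "b = arrow_map a"
    by blast
  then show "b \<in> {germ S s (pull \<xi>) | s \<xi>. s \<in> carrier S \<and> (cls s, \<xi>) \<in> germ_pairs Q}"
    using arrow_map_germ by (elim Q_arrowE) blast
next
  fix b assume "b \<in> {germ S s (pull \<xi>) | s \<xi>. s \<in> carrier S \<and> (cls s, \<xi>) \<in> germ_pairs Q}"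
  then obtain s \<xi> where "s \<in> carrier S" "(cls s, \<xi>) \<in> germ_pairs Q" "b = germ S s (pull \<xi>)"
    by blast
  then show "b \<in> arrow_map ` arrows GQ"
    using arrow_map_germ[of s \<xi>] Q.germ_in_arrows[of "cls s" \<xi>] by (metis image_eqI)
qed

lemma arrow_map_inj: "inj_on arrow_map (arrows GQ)"
proof (rule inj_onI)
  fix a b assume "a \<in> arrows GQ" "b \<in> arrows GQ" and eq: "arrow_map a = arrow_map b"
  then obtain s \<xi> t \<eta>
    where s: "s \<in> carrier S" "(cls s, \<xi>) \<in> germ_pairs Q" "a = germ Q (cls s) \<xi>"
      and t: "t \<in> carrier S" "(cls t, \<eta>) \<in> germ_pairs Q" "b = germ Q (cls t) \<eta>"
    by (elim Q_arrowE) blast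
  then show "a = b"
    using eq germ_pull_eq_iff[OF s(1,2) t(1,2)] arrow_map_germ by simp
qed

section \<open>Continuity and openness of the map on arrows\<close>

lemma D_set_pull:
  assumes "s \<in> carrier S"
  shows "\<xi> \<in> D_set Q (star Q (cls s) \<otimes>\<^bsub>Q\<^esub> cls s) \<longleftrightarrow> (cls s, \<xi>) \<in> germ_pairs Q"
  using assms by (simp add: Q.germ_pairs_iff_D_set cls_closed)

text \<open>The preimage of the basic set given by s and U is the basic set given by the class of s
  and the preimage of U under \<open>pull\<close>. Equal germs have equal characters, and
  \<open>germ_pull_eq_iff\<close> lifts the equality of germs back to the quotient.\<close>

lemma arrow_map_continuous: "continuous_map (arr_top GQ) (arr_top GF) arrow_map"
proof -
  have "continuous_map (arr_top GQ) (topology_generated_by (basic_sets S)) arrow_map"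
  proof (rule continuous_on_generated_topo)
    fix B assume "B \<in> basic_sets S"
    then obtain s U where s: "s \<in> carrier S" and U: "openin (character_space (idem S)) U"
      "U \<subseteq> D_set S (s\<^sup>\<star> \<otimes> s)" and B: "B = germ S s ` U"
      by (rule basic_setsE)
    define V where "V = {\<xi> \<in> characters (idem Q). pull \<xi> \<in> U}"
    have V: "(cls s, \<xi>) \<in> germ_pairs Q" if "\<xi> \<in> V" for \<xi>
    proof -
      have "\<xi> \<in> characters (idem Q)" "(s, pull \<xi>) \<in> germ_pairs S"
        using that s U(2) unfolding V_def germ_pairs_iff_D_set by blast+
      then show ?thesis
        using germ_pairs_pull[OF s] by blast
    qed
    have "arrow_map -` B \<inter> arrows GQ = germ Q (cls s) ` V"
    proof (intro equalityI subsetI)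
      fix a assume "a \<in> arrow_map -` B \<inter> arrows GQ"
      then have a: "a \<in> arrows GQ" and aB: "arrow_map a \<in> B"
        by blast+
      obtain t \<xi> where t: "t \<in> carrier S" "\<xi> \<in> characters (idem Q)" "(cls t, \<xi>) \<in> germ_pairs Q"
        "(t, pull \<xi>) \<in> germ_pairs S" "a = germ Q (cls t) \<xi>"
        using a by (rule Q_arrowE)
      obtain \<psi> where \<psi>: "\<psi> \<in> U" "germ S t (pull \<xi>) = germ S s \<psi>"
        using aB unfolding B t(5) arrow_map_germ[OF t(1,3)] by blast
      have "(s, \<psi>) \<in> germ_pairs S"
        using \<psi>(1) s U(2) unfolding germ_pairs_iff_D_set by blast
      then have "pull \<xi> = \<psi>"
        using \<psi>(2) germ_eq_iff[OF t(4)] by blast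
      then have "\<xi> \<in> V" "germ S t (pull \<xi>) = germ S s (pull \<xi>)"
        using \<psi> t(2) unfolding V_def by blast+
      then show "a \<in> germ Q (cls s) ` V"
        using germ_pull_eq_iff[OF t(1,3) s V] t(5) by blast
    next
      fix a assume "a \<in> germ Q (cls s) ` V"
      then obtain \<xi> where \<xi>: "\<xi> \<in> V" "a = germ Q (cls s) \<xi>"
        by blast
      then show "a \<in> arrow_map -` B \<inter> arrows GQ"
        using arrow_map_germ[OF s V] Q.germ_in_arrows[OF V] unfolding B V_def by blast
    qed
    moreover have "openin (arr_top GQ) (germ Q (cls s) ` V)"
    proof (rule Q.basic_setsI[OF cls_closed[OF s]])
      show "openin (character_space (idem Q)) V"
        using openin_continuous_map_preimage[OF pull_continuous U(1)]
        by (simp add: V_def Q.topspace_character_space)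
      show "V \<subseteq> D_set Q (star Q (cls s) \<otimes>\<^bsub>Q\<^esub> cls s)"
        using V D_set_pull[OF s] by blast
    qed
    ultimately show "openin (arr_top GQ) (arrow_map -` B \<inter> arrows GQ)"
      by simp
  next
    show "arrow_map ` arrows GQ \<subseteq> \<Union> (basic_sets S)"
      unfolding arrow_map_image arr_top_reduction arr_top_universal_groupoid by auto
  qed
  then have "continuous_map (arr_top GQ) (arr_top (universal_groupoid S)) arrow_map"
    unfolding arr_top_universal_groupoid .
  moreover have "arrow_map ` arrows GQ \<subseteq> {a \<in> arrows (universal_groupoid S).
      gdom (universal_groupoid S) a \<in> unit_germ S ` F_set S \<rho>}"
    unfolding arrow_map_image arr_top_reduction by auto
  ultimately show ?thesis
    unfolding arr_top_reduction continuous_map_in_subtopology image_subset_iff_funcset by blast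
qed

lemma arrow_map_basic_open:
  assumes "B \<in> basic_sets Q"
  shows "openin (arr_top GF) (arrow_map ` B)"
proof -
  obtain A V where A: "A \<in> carrier Q" and V: "openin (character_space (idem Q)) V"
    "V \<subseteq> D_set Q (star Q A \<otimes>\<^bsub>Q\<^esub> A)" and B: "B = germ Q A ` V"
    using assms by (rule Q.basic_setsE)
  obtain s where s: "s \<in> carrier S" "A = cls s"
    using A by (rule QE)
  have pairs: "(cls s, \<xi>) \<in> germ_pairs Q" if "\<xi> \<in> V" for \<xi>
    using that V(2) D_set_pull[OF s(1)] s(2) by blast
  obtain U where U: "openin (character_space (idem S)) U" "pull ` V = U \<inter> F_set S \<rho>"
    using V(1) by (rule pull_open)
  \<comment> \<open>The open set from \<open>pull_open\<close> may leave the domain of s, whereas a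
    basic set needs it inside; the pullbacks of V already lie there, so nothing of them is
    lost.\<close>
  define U' where "U' = U \<inter> D_set S (s\<^sup>\<star> \<otimes> s)"
  have "openin (arr_top (universal_groupoid S)) (germ S s ` U')"
    using s(1) U(1) openin_D_set[OF star_mult_idems(1)[OF s(1)]]
    by (intro basic_setsI) (auto simp: U'_def)
  then have "openin (arr_top GF) (arrows GF \<inter> germ S s ` U')"
    unfolding arr_top_reduction openin_subtopology topspace_subtopology using openin_subset by blast
  moreover have "arrow_map ` B = arrows GF \<inter> germ S s ` U'"
  proof (intro equalityI subsetI)
    fix b assume "b \<in> arrow_map ` B"
    then obtain \<xi> where \<xi>: "\<xi> \<in> V" "b = germ S s (pull \<xi>)"
      using arrow_map_germ[OF s(1) pairs] unfolding B s(2) by auto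
    have "pull \<xi> \<in> U"
      using U(2) \<xi>(1) by blast
    moreover have "pull \<xi> \<in> D_set S (s\<^sup>\<star> \<otimes> s)"
      using iffD1[OF germ_pairs_pull[OF s(1)] pairs[OF \<xi>(1)]] unfolding germ_pairs_iff_D_set by blast
    ultimately show "b \<in> arrows GF \<inter> germ S s ` U'"
      unfolding arrows_GF U'_def using \<xi>(2) s(1) pairs[OF \<xi>(1)] by blast
  next
    fix b assume "b \<in> arrows GF \<inter> germ S s ` U'"
    then obtain t \<xi> \<psi> where t: "b = germ S t (pull \<xi>)" "t \<in> carrier S" "(cls t, \<xi>) \<in> germ_pairs Q"
      and \<psi>: "b = germ S s \<psi>" "\<psi> \<in> U'"
      unfolding arrows_GF by blast
    have "(s, \<psi>) \<in> germ_pairs S"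
      using \<psi>(2) s(1) unfolding germ_pairs_iff_D_set U'_def by blast
    then have "\<psi> = pull \<xi>"
      using t \<psi>(1) germ_eq_iff[of t "pull \<xi>" s \<psi>] germ_pairs_pull by metis
    moreover have "\<xi> \<in> characters (idem Q)"
      using t germ_pairs_pull by blast
    ultimately have "\<psi> \<in> pull ` V"
      unfolding U(2) F_set_eq using \<psi>(2) U'_def by blast
    then obtain \<zeta> where "\<zeta> \<in> V" "\<psi> = pull \<zeta>"
      by blast
    then show "b \<in> arrow_map ` B"
      unfolding B s(2) \<psi>(1) image_image using arrow_map_germ[OF s(1) pairs] by blast
  qed
  ultimately show ?thesis
    by simp
qed

lemma arrow_map_homeomorphic: "homeomorphic_map (arr_top GQ) (arr_top GF) arrow_map"
proof -
  let ?g = "inv_into (arrows GQ) arrow_map"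
  have "continuous_map (arr_top GF) (topology_generated_by (basic_sets Q)) ?g"
  proof (rule continuous_on_generated_topo)
    fix B assume B: "B \<in> basic_sets Q"
    then have "B \<subseteq> arrows GQ"
      unfolding Q.arr_top_universal_groupoid by auto
    \<comment> \<open>Preimages under the inverse are images under \<open>arrow_map\<close>, so
      openness on basic sets gives continuity of the inverse.\<close>
    then have "?g -` B \<inter> arrows GF = arrow_map ` B"
      unfolding arrow_map_image[symmetric] using arrow_map_inj by auto
    then show "openin (arr_top GF) (?g -` B \<inter> arrows GF)"
      using arrow_map_basic_open[OF B] by simp
  next
    have "?g ` arrows GF \<subseteq> arrows GQ"
      unfolding arrow_map_image[symmetric] using arrow_map_inj by auto
    then show "?g ` arrows GF \<subseteq> \<Union> (basic_sets Q)"
      unfolding Q.arr_top_universal_groupoid by simp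
  qed
  then have "continuous_map (arr_top GF) (arr_top GQ) ?g"
    unfolding Q.arr_top_universal_groupoid .
  then have "homeomorphic_maps (arr_top GQ) (arr_top GF) arrow_map ?g"
    unfolding homeomorphic_maps_def arrow_map_image[symmetric]
    using arrow_map_continuous inv_into_f_f[OF arrow_map_inj] f_inv_into_f[of _ arrow_map "arrows GQ"]
    by blast
  then show ?thesis
    unfolding homeomorphic_map_maps by blast
qed

lemma arrow_map_iso: "tgroupoid_iso GQ GF arrow_map"
  unfolding tgroupoid_iso_def
proof (intro conjI ballI impI arrow_map_homeomorphic)
  have sel: "gdom GF = gdom (universal_groupoid S)" "grng GF = grng (universal_groupoid S)"
    "ginv GF = ginv (universal_groupoid S)" "gcomp GF = gcomp (universal_groupoid S)"
    by (simp_all add: reduction_def)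
  fix a assume "a \<in> arrows GQ"
  then obtain s \<xi> where s: "s \<in> carrier S" "\<xi> \<in> characters (idem Q)" "(cls s, \<xi>) \<in> germ_pairs Q"
    "(s, pull \<xi>) \<in> germ_pairs S" "a = germ Q (cls s) \<xi>"
    by (rule Q_arrowE)
  have a: "arrow_map (germ Q (cls s) \<xi>) = germ S s (pull \<xi>)"
    by (rule arrow_map_germ[OF s(1,3)])
  show "arrow_map (gdom GQ a) = gdom GF (arrow_map a)"
    unfolding s(5) a sel Q.gdom_germ[OF s(3)] gdom_germ[OF s(4)] by (rule arrow_map_unit_germ[OF s(2)])
  show "arrow_map (grng GQ a) = grng GF (arrow_map a)"
    unfolding s(5) a sel Q.grng_germ[OF s(3)] grng_germ[OF s(4)] pull_beta[OF s(1), symmetric]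
    by (rule arrow_map_unit_germ[OF Q.beta_character(1)[OF s(3)]])
  show "arrow_map (ginv GQ a) = ginv GF (arrow_map a)"
    unfolding s(5) a sel Q.ginv_germ[OF s(3)] ginv_germ[OF s(4)] pull_beta[OF s(1), symmetric] star_cls[OF s(1)]
    using Q.star_germ_pairs[OF s(3)] by (intro arrow_map_germ) (simp_all add: s(1) star_cls)
  fix b assume "b \<in> arrows GQ" and ab: "gdom GQ a = grng GQ b"
  then obtain t \<eta> where t: "t \<in> carrier S" "\<eta> \<in> characters (idem Q)" "(cls t, \<eta>) \<in> germ_pairs Q"
    "(t, pull \<eta>) \<in> germ_pairs S" "b = germ Q (cls t) \<eta>"
    by (elim Q_arrowE)
  have b: "arrow_map (germ Q (cls t) \<eta>) = germ S t (pull \<eta>)"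
    by (rule arrow_map_germ[OF t(1,3)])
  \<comment> \<open>Composability is an equality of unit arrows; injectivity of
    \<open>unit_germ\<close> turns it into the equality of characters that \<open>gcomp_germ\<close>
    needs.\<close>
  have \<xi>: "\<xi> = beta Q (cls t) \<eta>"
    using ab unfolding s(5) t(5) Q.gdom_germ[OF s(3)] Q.grng_germ[OF t(3)]
    by (rule Q.unit_germ_inj[OF s(2) Q.beta_character(1)[OF t(3)]])
  have pull_\<xi>: "pull \<xi> = beta S t (pull \<eta>)"
    unfolding \<xi> by (rule pull_beta[OF t(1)])
  have "gcomp GQ a b = germ Q (cls (s \<otimes> t)) \<eta>"
    using Q.gcomp_germ[OF s(3)[unfolded \<xi>] t(3)] unfolding s(5) t(5) \<xi> cls_mult[OF s(1) t(1)] .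
  moreover have "(cls (s \<otimes> t), \<eta>) \<in> germ_pairs Q"
    using Q.mult_germ_pairs[OF s(3)[unfolded \<xi>] t(3)] unfolding cls_mult[OF s(1) t(1)] .
  ultimately have "arrow_map (gcomp GQ a b) = germ S (s \<otimes> t) (pull \<eta>)"
    using arrow_map_germ[OF closed[OF s(1) t(1)]] by simp
  also have "\<dots> = gcomp GF (arrow_map a) (arrow_map b)"
    using gcomp_germ[OF s(4)[unfolded pull_\<xi>] t(4)] unfolding s(5) t(5) a b sel pull_\<xi> by simp
  finally show "arrow_map (gcomp GQ a b) = gcomp GF (arrow_map a) (arrow_map b)" .
qed

end

theorem proposition4p2p1:
  fixes S :: "'a sgrp" and \<rho> :: "('a \<times> 'a) set"
  assumes "inverse_semigroup S"
    and "normal_congruence S \<rho>"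
  shows "isomorphic_tgroupoids
    (universal_groupoid (quot_sgrp S (nu_min S \<rho>)))
    (reduction (universal_groupoid S) (unit_germ S ` F_set S \<rho>))"
proof -
  interpret normal_idem_congruence S \<rho>
    using assms by (simp add: normal_idem_congruence_def normal_idem_congruence_axioms_def)
  show ?thesis
    unfolding isomorphic_tgroupoids_def using arrow_map_iso by blast
qed

end
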